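(* Let $A=\sigma(R)\langle x_1,\dots,x_n\rangle$ be a bijective skew PBW extension of an LGS ring $R$, let $m\ge1$, and let $\mathrm{Mon}(A)$ and $\mathrm{Mon}(A^m)$ be endowed with monomial orders. Let $F=\{\mathbf f_1,\dots,\mathbf f_s\}$ be a set of non-zero vectors of $A^m$. Then the following algorithm (Buchberger's algorithm for modules over bijective skew PBW extensions) produces a Gröbner basis $G$ for the submodule $\langle\mathbf f_1,\dots,\mathbf f_s\rangle$ of the left $A$-module $A^m$ (here $P(X)$ is the set of subsets of $X$): Initialize $G:=\emptyset$, $G':=F$. While $G'\neq G$ do: put $D:=P(G')-P(G)$ and then $G:=G'$; for each $S=\{\mathbf g_{i_1},\dots,\mathbf g_{i_k}\}\in D$ with $\mathbf X_S\neq\mathbf 0$, compute $B_S$, and for each $(b_1,\dots,b_k)\in B_S$ reduce $\sum_{j=1}^k b_jx^{\gamma_j}\mathbf g_{i_j}\xrightarrow{\,G'\,}_+\mathbf r$ with $\mathbf r$ reduced with respect to $G'$, and if $\mathbf r\neq\mathbf 0$ put $G':=G'\cup\{\mathbf r\}$. Output $G$.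
   Context: Rings are associative with unit; $\mathbb N$ contains $0$. Skew PBW extensions. Let $R\subseteq A$ be rings. $A$ is a skew PBW extension of $R$, written $A=\sigma(R)\langle x_1,\dots,x_n\rangle$, if: (1) there are $x_1,\dots,x_n\in A$ such that $A$ is a free left $R$-module with basis $\mathrm{Mon}(A)=\{x^\alpha=x_1^{\alpha_1}\cdots x_n^{\alpha_n}\mid \alpha\in\mathbb N^n\}$; (2) for every $i$ and $r\in R\setminus\{0\}$ there is $c_{i,r}\in R\setminus\{0\}$ with $x_ir-c_{i,r}x_i\in R$; (3) for all $1\le i,j\le n$ there is $c_{i,j}\in R\setminus\{0\}$ with $x_jx_i-c_{i,j}x_ix_j\in R+Rx_1+\cdots+Rx_n$. Then for each $i$ there are an injective ring endomorphism $\sigma_i$ of $R$ and a $\sigma_i$-derivation $\delta_i$ of $R$ with $x_ir=\sigma_i(r)x_i+\delta_i(r)$ for all $r\in R$. $A$ is bijective if every $\sigma_i$ is bijective and $c_{i,j}$ is invertible for all $1\le i<j\le n$. Put $\sigma^\alpha:=\sigma_1^{\alpha_1}\cdots\sigma_n^{\alpha_n}$, $|\alpha|:=\alpha_1+\cdots+\alpha_n$, $\exp(x^\alpha):=\alpha$, $\deg(x^\alpha):=|\alpha|$, and for non-zero $f\in A$ let $\deg(f)$ be the maximal degree of its monomials. For $\alpha,\beta\in\mathbb N^n$ there are unique $c_{\alpha,\beta}\in R$, $p_{\alpha,\beta}\in A$ with $x^\alpha x^\beta=c_{\alpha,\beta}x^{\alpha+\beta}+p_{\alpha,\beta}$, where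 $p_{\alpha,\beta}=0$ or $\deg(p_{\alpha,\beta})<|\alpha+\beta|$. LGS rings. $R$ is left Gröbner soluble (LGS) if $R$ is left Noetherian; there is an algorithm deciding, for $a,r_1,\dots,r_m\in R$, whether $a\in Rr_1+\cdots+Rr_m$ and, if so, finding $b_i$ with $a=\sum b_ir_i$; and there is an algorithm computing a finite generating set of the left $R$-module $\mathrm{Syz}_R[r_1\ \cdots\ r_m]:=\{(b_1,\dots,b_m)\in R^m\mid b_1r_1+\cdots+b_mr_m=0\}$. Monomial orders on $\mathrm{Mon}(A)$. For a total order $\succeq$ on $\mathrm{Mon}(A)$, $lm(f)$ denotes the largest monomial occurring in $0\ne f\in A$. $\succeq$ is a monomial order if: $x^\beta\succeq x^\alpha$ implies $lm(x^\gamma x^\beta x^\lambda)\succeq lm(x^\gamma x^\alpha x^\lambda)$ for all $\gamma,\lambda$; $x^\alpha\succeq 1$ for all $\alpha$; and $|\beta|>|\alpha|$ implies $x^\beta\succeq x^\alpha$. (Then $lm(x^\alpha x^\beta)=x^{\alpha+\beta}$.) Monomials of $A^m$. Let $\mathbf e_1,\dots,\mathbf e_m$ be the canonical basis of $A^m$. $\mathrm{Mon}(A^m)$ is the set of $\mathbf X=X\mathbf e_i$ with $X=x^\alpha\in\mathrm{Mon}(A)$, $1\le i\le m$; $ind(\mathbf X):=i$, $\exp(\mathbf X):=\alpha$, $\deg(\mathbf X):=|\alpha|$. The least common multiple of $X\mathbf e_i$ and $Y\mathbf e_j$ is $\mathbf 0$ if $i\ne j$ and $lcm(X,Y)\mathbf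 e_i$ if $i=j$ (lcm of monomials of $A$ being given by componentwise maxima of exponents); the lcm of a finite set is defined accordingly, being $\mathbf 0$ unless all indices agree. A monomial order on $\mathrm{Mon}(A^m)$ is a total order $\succeq$ such that: $lm(x^\beta x^\alpha)\mathbf e_i\succeq x^\alpha\mathbf e_i$ always; $x^\beta\mathbf e_j\succeq x^\alpha\mathbf e_i$ implies $lm(x^\gamma x^\beta)\mathbf e_j\succeq lm(x^\gamma x^\alpha)\mathbf e_i$ for all $\gamma$; and $\deg(\mathbf X)>\deg(\mathbf Y)$ implies $\mathbf X\succeq\mathbf Y$. For $\mathbf 0\ne\mathbf f=c_1\mathbf X_1+\cdots+c_t\mathbf X_t$ with $c_i\in R\setminus\{0\}$, $\mathbf X_1\succ\cdots\succ\mathbf X_t$, put $lm(\mathbf f):=\mathbf X_1$, $lc(\mathbf f):=c_1$. Reduction. Let $F$ be a finite set of non-zero vectors of $A^m$. $\mathbf f\xrightarrow{F}\mathbf h$ (one step) means there are $\mathbf f_1,\dots,\mathbf f_t\in F$, $r_1,\dots,r_t\in R$, $\alpha_i\in\mathbb N^n$ with $ind(lm(\mathbf f_i))=ind(lm(\mathbf f))$ and $\alpha_i+\exp(lm(\mathbf f_i))=\exp(lm(\mathbf f))$ for all $i$, $lc(\mathbf f)=\sum_i r_i\sigma^{\alpha_i}(lc(\mathbf f_i))c_{\alpha_i,\exp(lm(\mathbf f_i))}$, and $\mathbf h=\mathbf f-\sum_i r_ix^{\alpha_i}\mathbf f_i$; by convention $\mathbf 0\xrightarrow{F}\mathbf 0$.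 $\mathbf f\xrightarrow{F}_+\mathbf h$ means $\mathbf h$ is obtained by finitely many one-step reductions. A non-zero $\mathbf f$ is reducible w.r.t. $F$ if a one-step reduction of $\mathbf f$ by $F$ exists; otherwise (or if $\mathbf f=\mathbf 0$) it is reduced. Gröbner bases. For a submodule $M\ne0$ of $A^m$, a non-empty finite set $G$ of non-zero vectors of $M$ is a Gröbner basis for $M$ if every $\mathbf 0\neq\mathbf f\in M$ is reducible w.r.t. $G$. $\{\mathbf 0\}$ is a Gröbner basis of $M=0$. The sets $B_S$. For $S=\{\mathbf g_{i_1},\dots,\mathbf g_{i_k}\}\subseteq A^m\setminus\{\mathbf 0\}$ let $\mathbf X_S$ be the least common multiple of $lm(\mathbf g_{i_1}),\dots,lm(\mathbf g_{i_k})$. If $\mathbf X_S\ne\mathbf 0$, put $\beta_j:=\exp(lm(\mathbf g_{i_j}))$ and let $\gamma_j\in\mathbb N^n$ satisfy $\gamma_j+\beta_j=\exp(\mathbf X_S)$. $B_S$ denotes a finite generating set of the left $R$-module $\mathrm{Syz}_R[\sigma^{\gamma_1}(lc(\mathbf g_{i_1}))c_{\gamma_1,\beta_1}\ \cdots\ \sigma^{\gamma_k}(lc(\mathbf g_{i_k}))c_{\gamma_k,\beta_k}]$. *)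

theory Defs
  imports
    "HOL-Analysis.Finite_Cartesian_Product"
    "HOL-Library.Function_Algebras"
    "HOL-Library.Nat_Bijection"
begin

section \<open>Partial recursive functions\<close>

text \<open>
  Kleene's partial recursive functions are the model for ``there is an algorithm''.
  Arities are not tracked: a program applied to too few arguments has no value.
\<close>

datatype precf =
    Zero
  | Succ
  | Proj nat
  | Comp precf "precf list"
  | Prec precf precf
  | Mu precf

inductive evals :: "precf \<Rightarrow> nat list \<Rightarrow> nat \<Rightarrow> bool" where
  "evals Zero xs 0"
| "evals Succ (a # xs) (Suc a)"
| "i < length xs \<Longrightarrow> evals (Proj i) xs (xs ! i)"
| "length ys = length gs \<Longrightarrow> (\<forall>i<length gs. evals (gs ! i) xs (ys ! i)) \<Longrightarrow> evals f ys z
    \<Longrightarrow> evals (Comp f gs) xs z"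
| "evals f xs y \<Longrightarrow> evals (Prec f g) (0 # xs) y"
| "evals (Prec f g) (k # xs) y \<Longrightarrow> evals g (k # y # xs) z \<Longrightarrow> evals (Prec f g) (Suc k # xs) z"
| "evals f (k # xs) 0 \<Longrightarrow> (\<forall>l<k. \<exists>y. y > 0 \<and> evals f (l # xs) y) \<Longrightarrow> evals (Mu f) xs k"

section \<open>Left Groebner soluble rings\<close>

text \<open>All rings are unital subrings of an ambient associative ring, given by their carrier sets.\<close>

definition unital_subring :: "'a::ring_1 set \<Rightarrow> bool" where
  "unital_subring R \<longleftrightarrow> 0 \<in> R \<and> 1 \<in> R \<and> (\<forall>a\<in>R. - a \<in> R) \<and>
     (\<forall>a\<in>R. \<forall>b\<in>R. a + b \<in> R \<and> a * b \<in> R)"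

definition left_ideal_of :: "'a::ring_1 set \<Rightarrow> 'a set \<Rightarrow> bool" where
  "left_ideal_of R I \<longleftrightarrow> I \<subseteq> R \<and> 0 \<in> I \<and> (\<forall>a\<in>I. \<forall>b\<in>I. a + b \<in> I) \<and> (\<forall>r\<in>R. \<forall>a\<in>I. r * a \<in> I)"

definition left_noetherian :: "'a::ring_1 set \<Rightarrow> bool" where
  "left_noetherian R \<longleftrightarrow>
     (\<forall>I :: nat \<Rightarrow> 'a set. (\<forall>k. left_ideal_of R (I k)) \<and> (\<forall>k. I k \<subseteq> I (Suc k))
        \<longrightarrow> (\<exists>N. \<forall>k\<ge>N. I k = I N))"

text \<open>
  Elements of the left \<open>R\<close>-module of \<open>J\<close>-indexed rows, \<open>J\<close> finite, are functions into \<open>R\<close> vanishing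
  outside \<open>J\<close>; addition and zero are pointwise.
\<close>

definition syz :: "'a::ring_1 set \<Rightarrow> 'i set \<Rightarrow> ('i \<Rightarrow> 'a) \<Rightarrow> ('i \<Rightarrow> 'a) set" where
  "syz R J r = {b. (\<forall>j\<in>J. b j \<in> R) \<and> (\<forall>j. j \<notin> J \<longrightarrow> b j = 0) \<and> (\<Sum>j\<in>J. b j * r j) = 0}"

definition row_submodule :: "'a::ring_1 set \<Rightarrow> ('i \<Rightarrow> 'a) set \<Rightarrow> bool" where
  "row_submodule R N \<longleftrightarrow> 0 \<in> N \<and> (\<forall>b\<in>N. \<forall>c\<in>N. b + c \<in> N) \<and> (\<forall>r\<in>R. \<forall>b\<in>N. (\<lambda>j. r * b j) \<in> N)"

definition finite_generating_set ::
  "'a::ring_1 set \<Rightarrow> ('i \<Rightarrow> 'a) set \<Rightarrow> ('i \<Rightarrow> 'a) set \<Rightarrow> bool" where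
  "finite_generating_set R B N \<longleftrightarrow> finite B \<and> row_submodule R hull B = N"

definition row_of :: "'a::zero list \<Rightarrow> nat \<Rightarrow> 'a" where
  "row_of bs = (\<lambda>j. if j < length bs then bs ! j else 0)"

text \<open>
  Ring elements enter and leave algorithms through a numbering \<open>\<nu>\<close> of \<open>R\<close> by natural numbers, which
  need not be injective.  The input is the coded list \<open>[a, r\<^sub>1, \<dots>, r\<^sub>m]\<close>; the answer is \<open>0\<close> for
  non-membership and otherwise the successor of a coded list of coefficients.
\<close>

definition solves_membership :: "(nat \<Rightarrow> 'a::ring_1) \<Rightarrow> precf \<Rightarrow> bool" where
  "solves_membership \<nu> p \<longleftrightarrow>
     (\<forall>a rs. \<exists>y. evals p [list_encode (a # rs)] y \<and>
        (if \<exists>b. (\<forall>j<length rs. b j \<in> range \<nu>) \<and> \<nu> a = (\<Sum>j<length rs. b j * \<nu> (rs ! j))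
         then \<exists>bs. y = Suc (list_encode bs) \<and> length bs = length rs \<and>
                \<nu> a = (\<Sum>j<length rs. \<nu> (bs ! j) * \<nu> (rs ! j))
         else y = 0))"

definition computes_syzygies :: "(nat \<Rightarrow> 'a::ring_1) \<Rightarrow> precf \<Rightarrow> bool" where
  "computes_syzygies \<nu> q \<longleftrightarrow>
     (\<forall>rs. \<exists>bss. evals q [list_encode rs] (list_encode (map list_encode bss)) \<and>
        (\<forall>bs\<in>set bss. length bs = length rs) \<and>
        finite_generating_set (range \<nu>) ((\<lambda>bs. row_of (map \<nu> bs)) ` set bss)
          (syz (range \<nu>) {..<length rs} (row_of (map \<nu> rs))))"

definition left_groebner_soluble :: "'a::ring_1 set \<Rightarrow> bool" where
  "left_groebner_soluble R \<longleftrightarrow> left_noetherian R \<and>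
     (\<exists>\<nu>. range \<nu> = R \<and> (\<exists>p. solves_membership \<nu> p) \<and> (\<exists>q. computes_syzygies \<nu> q))"

section \<open>Skew PBW extensions\<close>

text \<open>
  Elements of \<open>\<nat>\<^sup>n\<close> are functions vanishing at all \<open>i \<ge> n\<close>, with pointwise addition and subtraction.
  The variables are \<open>x 0, \<dots>, x (n - 1)\<close>, and the extension \<open>A\<close> is the whole type \<open>'a\<close>.
\<close>

type_synonym expo = "nat \<Rightarrow> nat"

locale pbw =
  fixes R :: "'a::ring_1 set" and n :: nat and x :: "nat \<Rightarrow> 'a"
begin

definition expos :: "expo set" where
  "expos = {\<alpha>. \<forall>i\<ge>n. \<alpha> i = 0}"

definition tdeg :: "expo \<Rightarrow> nat" where
  "tdeg \<alpha> = (\<Sum>i<n. \<alpha> i)"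

definition mon :: "expo \<Rightarrow> 'a" where
  "mon \<alpha> = prod_list (map (\<lambda>i. x i ^ \<alpha> i) [0..<n])"

definition represents :: "(expo \<Rightarrow> 'a) \<Rightarrow> 'a \<Rightarrow> bool" where
  "represents c f \<longleftrightarrow> finite {\<alpha>. c \<alpha> \<noteq> 0} \<and> {\<alpha>. c \<alpha> \<noteq> 0} \<subseteq> expos \<and> range c \<subseteq> R \<and>
     f = (\<Sum>\<alpha> | c \<alpha> \<noteq> 0. c \<alpha> * mon \<alpha>)"

definition affine_part :: "'a set" where
  "affine_part = {a + (\<Sum>k<n. b k * x k) | a b. a \<in> R \<and> (\<forall>k<n. b k \<in> R)}"

definition skew_pbw :: bool where
  "skew_pbw \<longleftrightarrow> unital_subring R \<and>
     (\<forall>f. \<exists>!c. represents c f) \<and>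
     (\<forall>i<n. \<forall>r\<in>R - {0}. \<exists>c\<in>R - {0}. x i * r - c * x i \<in> R) \<and>
     (\<forall>i<n. \<forall>j<n. \<exists>c\<in>R - {0}. x j * x i - c * x i * x j \<in> affine_part)"

text \<open>\<open>\<sigma>\<^sub>i(r)\<close> is the unique element of \<open>R\<close> with \<open>x\<^sub>i r = \<sigma>\<^sub>i(r) x\<^sub>i + \<delta>\<^sub>i(r)\<close>, \<open>\<delta>\<^sub>i(r) \<in> R\<close>.\<close>

definition sigma :: "nat \<Rightarrow> 'a \<Rightarrow> 'a" where
  "sigma i r = (THE s. s \<in> R \<and> x i * r - s * x i \<in> R)"

definition sigma_pow :: "expo \<Rightarrow> 'a \<Rightarrow> 'a" where
  "sigma_pow \<alpha> = foldr (\<lambda>i. sigma i ^^ \<alpha> i) [0..<n]"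

text \<open>For \<open>i < j\<close> the coefficient \<open>c\<^sub>i\<^sub>j\<close> is unique, because \<open>x\<^sub>i x\<^sub>j\<close> is a standard monomial.\<close>

definition bijective_skew_pbw :: bool where
  "bijective_skew_pbw \<longleftrightarrow> skew_pbw \<and>
     (\<forall>i<n. bij_betw (sigma i) R R) \<and>
     (\<forall>i j. i < j \<and> j < n \<longrightarrow>
        (\<exists>c\<in>R. (\<exists>d\<in>R. c * d = 1 \<and> d * c = 1) \<and> x j * x i - c * x i * x j \<in> affine_part))"

definition coeffs :: "'a \<Rightarrow> expo \<Rightarrow> 'a" where
  "coeffs f = (THE c. represents c f)"

definition supp :: "'a \<Rightarrow> expo set" where
  "supp f = {\<alpha>. coeffs f \<alpha> \<noteq> 0}"

definition deg :: "'a \<Rightarrow> nat" where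
  "deg f = Max (tdeg ` supp f)"

text \<open>The coefficient \<open>c\<^bsub>\<alpha>,\<beta>\<^esub>\<close> of the product of two monomials.\<close>

definition cmul :: "expo \<Rightarrow> expo \<Rightarrow> 'a" where
  "cmul \<alpha> \<beta> = (THE c. c \<in> R \<and>
     (\<exists>p. mon \<alpha> * mon \<beta> = c * mon (\<alpha> + \<beta>) + p \<and> (p = 0 \<or> deg p < tdeg (\<alpha> + \<beta>))))"

end

section \<open>Monomial orders\<close>

text \<open>
  Monomials are represented by their exponents, and monomials of \<open>A\<^sup>m\<close> by pairs of an exponent and an
  index.  An order is given by the relation of pairs \<open>(X, Y)\<close> with \<open>Y \<succeq> X\<close>.
\<close>

definition max_wrt :: "'b rel \<Rightarrow> 'b set \<Rightarrow> 'b" where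
  "max_wrt ord M = (THE a. a \<in> M \<and> (\<forall>b\<in>M. (b, a) \<in> ord))"

context pbw
begin

definition lm_ring :: "expo rel \<Rightarrow> 'a \<Rightarrow> expo" where
  "lm_ring ordA f = max_wrt ordA (supp f)"

definition monomial_order :: "expo rel \<Rightarrow> bool" where
  "monomial_order ordA \<longleftrightarrow> linear_order_on expos ordA \<and>
     (\<forall>\<alpha> \<beta>. (\<alpha>, \<beta>) \<in> ordA \<longrightarrow>
        (\<forall>\<gamma>\<in>expos. \<forall>\<eta>\<in>expos.
           (lm_ring ordA (mon \<gamma> * mon \<alpha> * mon \<eta>), lm_ring ordA (mon \<gamma> * mon \<beta> * mon \<eta>)) \<in> ordA)) \<and>
     (\<forall>\<alpha>\<in>expos. (0, \<alpha>) \<in> ordA) \<and>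
     (\<forall>\<alpha>\<in>expos. \<forall>\<beta>\<in>expos. tdeg \<beta> > tdeg \<alpha> \<longrightarrow> (\<alpha>, \<beta>) \<in> ordA)"

definition monomial_order_vec :: "expo rel \<Rightarrow> (expo \<times> 'm) rel \<Rightarrow> bool" where
  "monomial_order_vec ordA ord \<longleftrightarrow> linear_order_on (expos \<times> UNIV) ord \<and>
     (\<forall>\<alpha>\<in>expos. \<forall>\<beta>\<in>expos. \<forall>i. ((\<alpha>, i), (lm_ring ordA (mon \<beta> * mon \<alpha>), i)) \<in> ord) \<and>
     (\<forall>\<alpha> i \<beta> j. ((\<alpha>, i), (\<beta>, j)) \<in> ord \<longrightarrow>
        (\<forall>\<gamma>\<in>expos.
           ((lm_ring ordA (mon \<gamma> * mon \<alpha>), i), (lm_ring ordA (mon \<gamma> * mon \<beta>), j)) \<in> ord)) \<and>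
     (\<forall>\<alpha>\<in>expos. \<forall>\<beta>\<in>expos. \<forall>i j. tdeg \<beta> > tdeg \<alpha> \<longrightarrow> ((\<alpha>, i), (\<beta>, j)) \<in> ord)"

end

section \<open>Reduction and Groebner bases\<close>

definition submodule :: "('a::ring_1 ^ 'm) set \<Rightarrow> bool" where
  "submodule M \<longleftrightarrow> 0 \<in> M \<and> (\<forall>u\<in>M. \<forall>v\<in>M. u + v \<in> M) \<and> (\<forall>a. \<forall>v\<in>M. a *s v \<in> M)"

locale pbw_module = pbw R n x
  for R :: "'a::ring_1 set" and n :: nat and x :: "nat \<Rightarrow> 'a" +
  fixes ord :: "(expo \<times> 'm::finite) rel"
begin

definition lm :: "'a ^ 'm \<Rightarrow> expo \<times> 'm" where
  "lm f = max_wrt ord {(\<alpha>, i). coeffs (f $ i) \<alpha> \<noteq> 0}"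

definition lexpo :: "'a ^ 'm \<Rightarrow> expo" where
  "lexpo f = fst (lm f)"

definition lind :: "'a ^ 'm \<Rightarrow> 'm" where
  "lind f = snd (lm f)"

definition lc :: "'a ^ 'm \<Rightarrow> 'a" where
  "lc f = coeffs (f $ lind f) (lexpo f)"

definition red :: "('a ^ 'm) set \<Rightarrow> 'a ^ 'm \<Rightarrow> 'a ^ 'm \<Rightarrow> bool" where
  "red F f h \<longleftrightarrow> (f = 0 \<and> h = 0) \<or>
     (f \<noteq> 0 \<and> (\<exists>ts.
        (\<forall>(g, r, \<alpha>)\<in>set ts. g \<in> F \<and> r \<in> R \<and> \<alpha> \<in> expos \<and>
           lind g = lind f \<and> \<alpha> + lexpo g = lexpo f) \<and>
        lc f = (\<Sum>(g, r, \<alpha>)\<leftarrow>ts. r * sigma_pow \<alpha> (lc g) * cmul \<alpha> (lexpo g)) \<and>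
        h = f - (\<Sum>(g, r, \<alpha>)\<leftarrow>ts. (r * mon \<alpha>) *s g)))"

definition reducible :: "('a ^ 'm) set \<Rightarrow> 'a ^ 'm \<Rightarrow> bool" where
  "reducible F f \<longleftrightarrow> f \<noteq> 0 \<and> (\<exists>h. red F f h)"

definition groebner_basis :: "('a ^ 'm) set \<Rightarrow> ('a ^ 'm) set \<Rightarrow> bool" where
  "groebner_basis G M \<longleftrightarrow>
     (if M = {0} then G = {0}
      else finite G \<and> G \<noteq> {} \<and> G \<subseteq> M - {0} \<and> (\<forall>f\<in>M - {0}. reducible G f))"

section \<open>The algorithm\<close>

text \<open>The least common multiple \<open>\<^bold>X\<^sub>S\<close> of a non-empty finite set; \<open>None\<close> stands for \<open>\<^bold>0\<close>.\<close>

definition lcm_of :: "('a ^ 'm) set \<Rightarrow> (expo \<times> 'm) option" where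
  "lcm_of S = (if \<exists>k. lind ` S = {k}
     then Some (\<lambda>i. Max ((\<lambda>g. lexpo g i) ` S), the_elem (lind ` S)) else None)"

text \<open>
  In the next two definitions \<open>\<theta>\<close> is the exponent of \<open>\<^bold>X\<^sub>S\<close>, so that \<open>\<theta> - lexpo g\<close> is the exponent \<open>\<gamma>\<close>
  with \<open>\<gamma> + lexpo g = \<theta>\<close>.  Rows of coefficients are indexed by the elements of \<open>S\<close> themselves.
\<close>

definition is_BS :: "('a ^ 'm) set \<Rightarrow> expo \<Rightarrow> (('a ^ 'm) \<Rightarrow> 'a) set \<Rightarrow> bool" where
  "is_BS S \<theta> B \<longleftrightarrow> finite_generating_set R B
     (syz R S (\<lambda>g. sigma_pow (\<theta> - lexpo g) (lc g) * cmul (\<theta> - lexpo g) (lexpo g)))"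

definition combination :: "('a ^ 'm) set \<Rightarrow> expo \<Rightarrow> (('a ^ 'm) \<Rightarrow> 'a) \<Rightarrow> 'a ^ 'm" where
  "combination S \<theta> b = (\<Sum>g\<in>S. (b g * mon (\<theta> - lexpo g)) *s g)"

text \<open>
  A state \<open>(G, G', D, P)\<close> holds the two program variables, the set \<open>D\<close> of subsets still to be visited
  in the current pass of the while loop, and the set \<open>P\<close> of combinations still to be reduced for the
  subset being visited, each given by that subset \<open>S\<close>, the exponent of \<open>\<^bold>X\<^sub>S\<close>, and an element of \<open>B\<^sub>S\<close>.
  The order of the traversals, the sets \<open>B\<^sub>S\<close> and the reductions are chosen nondeterministically, and
  reduction always uses the current value of \<open>G'\<close>.
\<close>

inductive step ::
  "('a ^ 'm) set \<times> ('a ^ 'm) set \<times> ('a ^ 'm) set set \<times> (('a ^ 'm) set \<times> expo \<times> (('a ^ 'm) \<Rightarrow> 'a)) set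
   \<Rightarrow> ('a ^ 'm) set \<times> ('a ^ 'm) set \<times> ('a ^ 'm) set set \<times> (('a ^ 'm) set \<times> expo \<times> (('a ^ 'm) \<Rightarrow> 'a)) set
   \<Rightarrow> bool" where
  enter_loop: "G' \<noteq> G \<Longrightarrow> step (G, G', {}, {}) (G', G', Pow G' - Pow G, {})"
| skip: "S \<in> D \<Longrightarrow> lcm_of S = None \<Longrightarrow> step (G, G', D, {}) (G, G', D - {S}, {})"
| visit: "S \<in> D \<Longrightarrow> lcm_of S = Some (\<theta>, k) \<Longrightarrow> is_BS S \<theta> B
    \<Longrightarrow> step (G, G', D, {}) (G, G', D - {S}, {S} \<times> {\<theta>} \<times> B)"
| reduce: "(S, \<theta>, b) \<in> P \<Longrightarrow> (red G')\<^sup>*\<^sup>* (combination S \<theta> b) r \<Longrightarrow> \<not> reducible G' r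
    \<Longrightarrow> step (G, G', D, P) (G, if r = 0 then G' else insert r G', D, P - {(S, \<theta>, b)})"

end

end

theory Submission
  imports Defs "HOL-Library.Infinite_Set"
begin

text \<open>
  Coefficients do not commute with the variables, and monomials do not multiply to monomials, but
  modulo terms of lower total degree both happen up to harmless twists: \<open>x\<^sup>\<alpha> r\<close> is
  \<open>\<sigma>\<^sup>\<alpha>(r) x\<^sup>\<alpha>\<close> and \<open>x\<^sup>\<alpha> x\<^sup>\<beta>\<close> is \<open>c x\<^sup>\<alpha>\<^sup>+\<^sup>\<beta>\<close> with \<open>c\<close> a unit of \<open>R\<close>
  (\<open>mon_scalar\<close>, \<open>cmul_mon\<close>, \<open>cmul_runit\<close>).  The monomial orders refine the total degree, so on
  leading terms the calculation is the commutative one with twisted coefficients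
  (\<open>vcoeff_mon\<close>).  Bijectivity of the \<open>\<sigma>\<^sub>i\<close> and invertibility of the \<open>c\<close> allow the twists to be undone.

  Termination.  Write the leading coefficient of \<open>f\<close> as \<open>\<sigma>\<^sup>\<beta>(\<rho>(f))\<close>, where \<open>\<beta>\<close> is its leading
  exponent.  Then \<open>f\<close> is reducible by \<open>F\<close> as soon as \<open>\<rho>(f)\<close> lies in the left ideal generated by the
  \<open>\<rho>(g)\<close> for those \<open>g \<in> F\<close> whose leading monomial divides that of \<open>f\<close>
  (\<open>reducible_if_ideal\<close>).  In an infinite sequence of vectors irreducible with respect to their
  predecessors, Dickson's lemma would yield a subsequence with leading monomials successively dividing each
  other, and the \<open>\<rho>\<close> of that subsequence would generate a strictly increasing chain of left ideals
  (\<open>no_infinite_irreducible_sequence\<close>).  Hence \<open>G'\<close> grows only finitely often, and between two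
  growths the remaining work decreases (\<open>step_progress\<close>).

  Correctness.  When the loop ends, each combination attached to an element of a \<open>B\<^sub>S\<close> is a sum of
  terms \<open>r x\<^sup>\<alpha> g\<close> whose leading monomials lie strictly below \<open>\<^bold>X\<^sub>S\<close>, and by linearity
  this extends to all syzygies (\<open>resolved_syz\<close>).  Express a vector of the module as a sum of terms
  \<open>r x\<^sup>\<alpha> g\<close>.  If the largest monomial \<open>\<^bold>X\<close> at which terms lead exceeds the leading monomial of the vector, the
  coefficients at \<open>\<^bold>X\<close> cancel; up to smaller terms, the part at \<open>\<^bold>X\<close> is then a monomial multiple of the
  combination belonging to a syzygy, hence again a sum of smaller terms
  (\<open>cancelling_top_part\<close>).  The order is well-founded, so the largest terms can be taken
  to lie at the leading monomial, where their coefficients add up to the leading coefficient: this is a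
  reduction step (\<open>resolved_imp_reducible\<close>).

  A run cannot get stuck before the loop is left: the sets \<open>B\<^sub>S\<close> exist by the syzygy part of Groebner
  solubility, and every vector can be reduced to a reduced one because leading monomials decrease
  (\<open>step_exists\<close>).
\<close>

section \<open>Maxima and monotone subsequences\<close>

lemma max_wrt_props:
  assumes "linear_order_on E ord" "finite M" "M \<noteq> {}" "M \<subseteq> E"
  shows "max_wrt ord M \<in> M" "\<And>b. b \<in> M \<Longrightarrow> (b, max_wrt ord M) \<in> ord"
proof -
  have rf: "refl_on E ord" and tr: "trans ord" and an: "antisym ord" and tot: "total_on E ord"
    using assms(1) by (auto simp: linear_order_on_def partial_order_on_def preorder_on_def)
  have "\<exists>a. a \<in> M \<and> (\<forall>b\<in>M. (b, a) \<in> ord)" using assms(2-4)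
  proof (induction M rule: finite_ne_induct)
    case (singleton y)
    then show ?case using rf by (auto simp: refl_on_def)
  next
    case (insert y N)
    then obtain a where a: "a \<in> N" "\<forall>b\<in>N. (b, a) \<in> ord" by auto
    have "(y, y) \<in> ord" using insert rf by (auto simp: refl_on_def)
    have ya: "y \<in> E" "a \<in> E" "y \<noteq> a" using insert a by auto
    then have "(y, a) \<in> ord \<or> (a, y) \<in> ord" using tot by (auto simp: total_on_def)
    then show ?case
    proof
      assume "(y, a) \<in> ord" then show ?thesis using a by auto
    next
      assume "(a, y) \<in> ord"
      then have "\<forall>b\<in>N. (b, y) \<in> ord" using a tr by (meson transD)
      then show ?thesis using \<open>(y, y) \<in> ord\<close> by auto
    qed
  qed
  then have "\<exists>!a. a \<in> M \<and> (\<forall>b\<in>M. (b, a) \<in> ord)" using an by (auto simp: antisym_def)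
  from theI'[OF this] show "max_wrt ord M \<in> M" "\<And>b. b \<in> M \<Longrightarrow> (b, max_wrt ord M) \<in> ord"
    unfolding max_wrt_def by auto
qed

lemma max_wrt_eqI:
  assumes "linear_order_on E ord" "a \<in> M" "\<And>b. b \<in> M \<Longrightarrow> (b, a) \<in> ord"
  shows "max_wrt ord M = a"
  unfolding max_wrt_def
proof (rule the_equality)
  show "a \<in> M \<and> (\<forall>b\<in>M. (b, a) \<in> ord)" using assms by auto
  fix b assume "b \<in> M \<and> (\<forall>c\<in>M. (c, b) \<in> ord)"
  moreover have "antisym ord" using assms(1) by (auto simp: linear_order_on_def partial_order_on_def)
  ultimately show "b = a" using assms(2,3) by (auto simp: antisym_def)
qed

text \<open>
  A decreasing sequence of naturals is eventually constant, so a monotone subsequence, which every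
  sequence has, becomes increasing after finitely many entries are dropped.
\<close>

lemma nat_mono_subseq:
  fixes f :: "nat \<Rightarrow> nat"
  obtains r :: "nat \<Rightarrow> nat" where "strict_mono r" "mono (f \<circ> r)"
proof -
  obtain r where r: "strict_mono r" "monoseq (f \<circ> r)"
    using seq_monosub[of f] by (auto simp: o_def)
  show ?thesis
  proof (cases "mono (f \<circ> r)")
    case True then show ?thesis using that r by blast
  next
    case False
    then have dec: "antimono (f \<circ> r)"
      using r(2) by (auto simp: monoseq_iff)
    define m where "m = (LEAST y. y \<in> range (f \<circ> r))"
    have "m \<in> range (f \<circ> r)" unfolding m_def by (rule LeastI) blast
    then obtain N where N: "m = (f \<circ> r) N" by blast
    have c: "(f \<circ> r) (N + k) = m" for k
    proof (rule antisym)
      show "(f \<circ> r) (N + k) \<le> m" using antimonoD[OF dec, of N "N + k"] N by simp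
      show "m \<le> (f \<circ> r) (N + k)" unfolding m_def by (rule Least_le) blast
    qed
    have "strict_mono (\<lambda>k. r (N + k))" using r(1) by (auto simp: strict_mono_def)
    moreover have "mono (f \<circ> (\<lambda>k. r (N + k)))" using c by (auto simp: mono_def)
    ultimately show ?thesis using that by blast
  qed
qed

text \<open>
  Dickson's lemma in the form of subsequences: the coordinates are made monotone one after the other.
\<close>

lemma dickson_subseq:
  fixes f :: "nat \<Rightarrow> 'i \<Rightarrow> nat"
  assumes "finite I"
  shows "\<exists>r :: nat \<Rightarrow> nat. strict_mono r \<and> (\<forall>i\<in>I. mono (\<lambda>k. f (r k) i))"
  using assms
proof (induction I)
  case empty
  show ?case by (intro exI[of _ id]) (simp add: strict_mono_def)
next
  case (insert i I)
  then obtain r :: "nat \<Rightarrow> nat" where r: "strict_mono r" "\<forall>i\<in>I. mono (\<lambda>k. f (r k) i)" by blast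
  obtain s :: "nat \<Rightarrow> nat" where s: "strict_mono s" "mono ((\<lambda>k. f (r k) i) \<circ> s)" by (rule nat_mono_subseq)
  have "strict_mono (r \<circ> s)" using r(1) s(1) by (rule strict_mono_o)
  moreover have "mono (\<lambda>k. f ((r \<circ> s) k) j)" if "j \<in> insert i I" for j
  proof (cases "j = i")
    case True then show ?thesis using s by (simp add: o_def)
  next
    case False
    then have "mono (\<lambda>k. f (r k) j)" using that r by auto
    then show ?thesis using strict_mono_mono[OF s(1)] by (auto simp: mono_def)
  qed
  ultimately show ?case by blast
qed

lemma finite_constant_subseq:
  fixes f :: "nat \<Rightarrow> 'b::finite"
  obtains r :: "nat \<Rightarrow> nat" and c where "strict_mono r" "\<And>k. f (r k) = c"
proof -
  obtain n where "infinite {k. f k = f n}"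
    using pigeonhole_infinite[of UNIV f] by auto
  then obtain r :: "nat \<Rightarrow> nat" where "strict_mono r" "\<And>k. r k \<in> {k. f k = f n}"
    using infinite_enumerate[of "{k. f k = f n}"] by blast
  then show ?thesis using that by auto
qed

section \<open>Generating sets of syzygy modules\<close>

lemma row_submodule_hull: "row_submodule R (row_submodule R hull B)"
  by (rule hull_in) (auto simp: row_submodule_def)

lemma submodule_hull: "submodule (submodule hull B)"
  by (rule hull_in) (auto simp: submodule_def)

text \<open>
  Both inclusions come from minimality of the hull, since images and preimages of submodules under a
  linear map are submodules.
\<close>

lemma row_submodule_hull_image:
  fixes T :: "('i \<Rightarrow> 'a::ring_1) \<Rightarrow> 'j \<Rightarrow> 'a"
  assumes "T 0 = 0" "\<And>b c. T (b + c) = T b + T c" "\<And>r b. T (\<lambda>i. r * b i) = (\<lambda>j. r * T b j)"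
  shows "row_submodule R hull (T ` B) = T ` (row_submodule R hull B)"
proof
  note h = row_submodule_hull[of R B, unfolded row_submodule_def[of R "row_submodule R hull B"]]
  have "row_submodule R (T ` (row_submodule R hull B))"
    unfolding row_submodule_def[of R "T ` (row_submodule R hull B)"]
  proof (intro conjI ballI)
    show "0 \<in> T ` (row_submodule R hull B)" using imageI[of 0 "row_submodule R hull B" T] h assms(1) by simp
  next
    fix b c assume "b \<in> T ` (row_submodule R hull B)" "c \<in> T ` (row_submodule R hull B)"
    then show "b + c \<in> T ` (row_submodule R hull B)" using h assms(2)[symmetric] by auto
  next
    fix r b assume "r \<in> R" "b \<in> T ` (row_submodule R hull B)"
    then show "(\<lambda>j. r * b j) \<in> T ` (row_submodule R hull B)" using h assms(3)[symmetric] by auto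
  qed
  then show "row_submodule R hull (T ` B) \<subseteq> T ` (row_submodule R hull B)"
    by (intro hull_minimal image_mono hull_subset)
next
  note h = row_submodule_hull[of R "T ` B", unfolded row_submodule_def[of R "row_submodule R hull (T ` B)"]]
  have "row_submodule R {b. T b \<in> row_submodule R hull (T ` B)}"
    unfolding row_submodule_def[of R "{b. T b \<in> row_submodule R hull (T ` B)}"]
    using h assms by simp
  moreover have "B \<subseteq> {b. T b \<in> row_submodule R hull (T ` B)}"
    using hull_subset[of "T ` B" "row_submodule R"] by blast
  ultimately have "row_submodule R hull B \<subseteq> {b. T b \<in> row_submodule R hull (T ` B)}"
    by (rule hull_minimal[rotated])
  then show "T ` (row_submodule R hull B) \<subseteq> row_submodule R hull (T ` B)" by blast
qed

text \<open>
  The syzygy algorithm provides generators for rows indexed by initial segments of the naturals.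
  Enumerating \<open>S\<close> carries them over to rows indexed by \<open>S\<close>; the map \<open>T\<close> is this relabelling.
\<close>

lemma syz_finitely_generated:
  fixes w :: "'j \<Rightarrow> 'a::ring_1"
  assumes "left_groebner_soluble R" "finite S" "\<And>g. g \<in> S \<Longrightarrow> w g \<in> R"
  shows "\<exists>B. finite_generating_set R B (syz R S w)"
proof -
  obtain \<nu> q where \<nu>: "range \<nu> = R" "computes_syzygies \<nu> q"
    using assms(1) unfolding left_groebner_soluble_def by blast
  obtain l where l: "set l = S" "distinct l" using finite_distinct_list[OF assms(2)] by blast
  have "\<forall>g\<in>S. \<exists>r. \<nu> r = w g" using assms(3) \<nu>(1) by (metis imageE)
  then obtain c where c: "\<And>g. g \<in> S \<Longrightarrow> \<nu> (c g) = w g" by metis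
  let ?m = "length l"
  have w: "row_of (map \<nu> (map c l)) j = w (l ! j)" if "j < ?m" for j
    using that c[of "l ! j"] l by (auto simp: row_of_def)
  obtain bss where "finite_generating_set (range \<nu>) ((\<lambda>bs. row_of (map \<nu> bs)) ` set bss)
      (syz (range \<nu>) {..<length (map c l)} (row_of (map \<nu> (map c l))))"
    using \<nu>(2) unfolding computes_syzygies_def by blast
  then obtain B where B: "finite B"
    "row_submodule R hull B = syz R {..<?m} (row_of (map \<nu> (map c l)))"
    unfolding finite_generating_set_def \<nu>(1) by auto
  have bij: "bij_betw ((!) l) {..<?m} S" using bij_betw_nth[OF l(2), of "{..<?m}" S] l(1) by simp
  define idx where "idx = inv_into {..<?m} ((!) l)"
  have idx: "idx g < ?m" "l ! idx g = g" if "g \<in> S" for g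
    using bij that inv_into_into[of g "(!) l" "{..<?m}"] f_inv_into_f[of g "(!) l" "{..<?m}"]
    unfolding idx_def bij_betw_def by auto
  have idx_nth: "idx (l ! j) = j" if "j < ?m" for j
    using bij that by (simp add: idx_def bij_betw_inv_into_left)
  define T where "T b = (\<lambda>g. if g \<in> S then b (idx g) else (0::'a))" for b
  have "T ` syz R {..<?m} (row_of (map \<nu> (map c l))) = syz R S w"
  proof (intro equalityI subsetI)
    fix t assume "t \<in> T ` syz R {..<?m} (row_of (map \<nu> (map c l)))"
    then obtain b where b: "t = T b" "\<And>j. j < ?m \<Longrightarrow> b j \<in> R"
      "(\<Sum>j<?m. b j * row_of (map \<nu> (map c l)) j) = 0"
      unfolding syz_def by blast
    have "(\<Sum>g\<in>S. t g * w g) = (\<Sum>j<?m. t (l ! j) * w (l ! j))"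
      by (rule sum.reindex_bij_betw[OF bij, symmetric])
    also have "\<dots> = (\<Sum>j<?m. b j * row_of (map \<nu> (map c l)) j)"
      using w idx_nth l(1) by (intro sum.cong) (auto simp: b T_def)
    finally show "t \<in> syz R S w" using b idx by (auto simp: syz_def T_def)
  next
    fix t assume t: "t \<in> syz R S w"
    define b where "b j = (if j < ?m then t (l ! j) else 0)" for j
    have "(\<Sum>g\<in>S. t g * w g) = (\<Sum>j<?m. t (l ! j) * w (l ! j))"
      by (rule sum.reindex_bij_betw[OF bij, symmetric])
    also have "\<dots> = (\<Sum>j<?m. b j * row_of (map \<nu> (map c l)) j)"
      using w by (intro sum.cong) (auto simp: b_def)
    finally have "(\<Sum>j<?m. b j * row_of (map \<nu> (map c l)) j) = 0" using t by (simp add: syz_def)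
    then have "b \<in> syz R {..<?m} (row_of (map \<nu> (map c l)))"
      using t l(1) by (auto simp: syz_def b_def)
    moreover have "t = T b"
      using t idx by (auto simp: T_def b_def syz_def fun_eq_iff)
    ultimately show "t \<in> T ` syz R {..<?m} (row_of (map \<nu> (map c l)))" by blast
  qed
  moreover have "row_submodule R hull (T ` B) = T ` (row_submodule R hull B)"
    by (rule row_submodule_hull_image) (auto simp: T_def fun_eq_iff)
  ultimately have "finite_generating_set R (T ` B) (syz R S w)"
    using B by (simp add: finite_generating_set_def)
  then show ?thesis by blast
qed

section \<open>Rings of coefficients and their units\<close>

locale bijective_pbw = pbw R n x for R :: "'a::ring_1 set" and n x +
  assumes bijective: "bijective_skew_pbw"
begin

lemma skew: skew_pbw using bijective by (simp add: bijective_skew_pbw_def)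

lemma R_closed [simp]:
  "0 \<in> R" "1 \<in> R" "a \<in> R \<Longrightarrow> - a \<in> R" "a \<in> R \<Longrightarrow> b \<in> R \<Longrightarrow> a + b \<in> R"
  "a \<in> R \<Longrightarrow> b \<in> R \<Longrightarrow> a * b \<in> R" "a \<in> R \<Longrightarrow> b \<in> R \<Longrightarrow> a - b \<in> R"
  using skew unfolding skew_pbw_def unital_subring_def
  by (auto simp: diff_conv_add_uminus simp del: add_uminus_conv_diff)

lemma R_sum: "(\<And>i. i \<in> I \<Longrightarrow> f i \<in> R) \<Longrightarrow> sum f I \<in> R"
  by (induction I rule: infinite_finite_induct) auto

definition runit :: "'a \<Rightarrow> bool" where
  "runit u \<longleftrightarrow> u \<in> R \<and> (\<exists>v\<in>R. u * v = 1 \<and> v * u = 1)"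

lemma runit_R: "runit u \<Longrightarrow> u \<in> R" by (simp add: runit_def)

lemma runit_1: "runit 1" unfolding runit_def by auto

lemma runit_mult: assumes "runit a" "runit b" shows "runit (a * b)"
proof -
  obtain c d where "c \<in> R" "d \<in> R" "a * c = 1" "c * a = 1" "b * d = 1" "d * b = 1"
    using assms unfolding runit_def by auto
  then have "(a * b) * (d * c) = 1" "(d * c) * (a * b) = 1"
    by (metis mult.assoc mult.right_neutral)+
  then show ?thesis using assms \<open>c \<in> R\<close> \<open>d \<in> R\<close> unfolding runit_def by (metis R_closed(5))
qed

lemma runit_cancel: assumes "runit u" "a * u = 0" shows "a = 0"
proof -
  obtain v where "u * v = 1" using assms unfolding runit_def by auto
  then have "a = a * u * v" by (simp add: mult.assoc)
  then show ?thesis using assms by simp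
qed

section \<open>Coefficients\<close>

lemma representsI:
  assumes "finite T" "T \<subseteq> expos" "range c \<subseteq> R" "\<And>\<alpha>. \<alpha> \<notin> T \<Longrightarrow> c \<alpha> = 0"
    "f = (\<Sum>\<alpha>\<in>T. c \<alpha> * mon \<alpha>)"
  shows "represents c f"
proof -
  have sub: "{\<alpha>. c \<alpha> \<noteq> 0} \<subseteq> T" using assms(4) by auto
  then have "(\<Sum>\<alpha>\<in>T. c \<alpha> * mon \<alpha>) = (\<Sum>\<alpha> | c \<alpha> \<noteq> 0. c \<alpha> * mon \<alpha>)"
    using assms(1) by (intro sum.mono_neutral_right) auto
  then show ?thesis using sub assms unfolding represents_def by (auto dest: finite_subset)
qed

lemma represents_unique: "\<exists>!c. represents c f"
  using skew unfolding skew_pbw_def by blast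

lemma coeffs_eqI: "represents c f \<Longrightarrow> coeffs f = c"
  unfolding coeffs_def using represents_unique by (intro the1_equality) auto

lemma represents_coeffs: "represents (coeffs f) f"
  using represents_unique coeffs_eqI by metis

lemma finite_supp: "finite (supp f)"
  and supp_expos: "supp f \<subseteq> expos"
  and coeffs_R: "coeffs f \<alpha> \<in> R"
  and expand: "f = (\<Sum>\<alpha>\<in>supp f. coeffs f \<alpha> * mon \<alpha>)"
  using represents_coeffs[of f] unfolding represents_def supp_def by auto

lemma supp_iff: "\<alpha> \<in> supp f \<longleftrightarrow> coeffs f \<alpha> \<noteq> 0" by (simp add: supp_def)

lemma expand_superset:
  assumes "finite T" "supp f \<subseteq> T"
  shows "f = (\<Sum>\<alpha>\<in>T. coeffs f \<alpha> * mon \<alpha>)"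
proof -
  have "(\<Sum>\<alpha>\<in>T. coeffs f \<alpha> * mon \<alpha>) = (\<Sum>\<alpha>\<in>supp f. coeffs f \<alpha> * mon \<alpha>)"
    using assms by (intro sum.mono_neutral_right) (auto simp: supp_iff)
  then show ?thesis using expand[of f] by simp
qed

lemma coeffs_add: "coeffs (f + g) \<alpha> = coeffs f \<alpha> + coeffs g \<alpha>"
proof -
  let ?T = "supp f \<union> supp g"
  have "f = (\<Sum>\<alpha>\<in>?T. coeffs f \<alpha> * mon \<alpha>)" "g = (\<Sum>\<alpha>\<in>?T. coeffs g \<alpha> * mon \<alpha>)"
    by (auto intro!: expand_superset simp: finite_supp)
  then have "f + g = (\<Sum>\<alpha>\<in>?T. (coeffs f \<alpha> + coeffs g \<alpha>) * mon \<alpha>)"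
    by (simp add: sum.distrib distrib_right)
  then have "represents (\<lambda>\<alpha>. coeffs f \<alpha> + coeffs g \<alpha>) (f + g)"
    by (intro representsI[of ?T]) (use finite_supp supp_expos coeffs_R in \<open>auto simp: supp_iff\<close>)
  then show ?thesis using coeffs_eqI by fastforce
qed

lemma coeffs_lmult: assumes "r \<in> R" shows "coeffs (r * f) \<alpha> = r * coeffs f \<alpha>"
proof -
  have "r * f = (\<Sum>\<alpha>\<in>supp f. (r * coeffs f \<alpha>) * mon \<alpha>)"
    using arg_cong[OF expand[of f], of "(*) r"] by (simp add: sum_distrib_left mult.assoc)
  then have "represents (\<lambda>\<alpha>. r * coeffs f \<alpha>) (r * f)"
    by (intro representsI[of "supp f"]) (use finite_supp supp_expos coeffs_R assms in \<open>auto simp: supp_iff\<close>)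
  then show ?thesis using coeffs_eqI by fastforce
qed

lemma coeffs_0 [simp]: "coeffs 0 \<alpha> = 0"
  using coeffs_lmult[of 0 0 \<alpha>] by simp

lemma coeffs_uminus: "coeffs (- f) \<alpha> = - coeffs f \<alpha>"
  using coeffs_lmult[of "-1" f \<alpha>] by simp

lemma coeffs_diff: "coeffs (f - g) \<alpha> = coeffs f \<alpha> - coeffs g \<alpha>"
  using coeffs_add[of f "- g"] by (simp add: coeffs_uminus)

lemma coeffs_sum: "coeffs (sum f I) \<alpha> = (\<Sum>i\<in>I. coeffs (f i) \<alpha>)"
  by (induction I rule: infinite_finite_induct) (auto simp: coeffs_add)

lemma coeffs_term:
  assumes "\<alpha> \<in> expos" "r \<in> R"
  shows "coeffs (r * mon \<alpha>) = (\<lambda>\<beta>. if \<beta> = \<alpha> then r else 0)"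
  by (rule coeffs_eqI, rule representsI[of "{\<alpha>}"]) (use assms in auto)

lemma coeffs_eq_0: "(\<And>\<alpha>. coeffs f \<alpha> = 0) \<Longrightarrow> f = 0"
  using expand[of f] by simp

section \<open>Exponents\<close>

definition bump :: "nat \<Rightarrow> expo \<Rightarrow> expo" where
  "bump j \<alpha> = \<alpha>(j := Suc (\<alpha> j))"

lemma bump_apply: "bump j \<alpha> i = (if i = j then Suc (\<alpha> i) else \<alpha> i)"
  by (simp add: bump_def)

lemma expos_add [simp]: "\<alpha> \<in> expos \<Longrightarrow> \<beta> \<in> expos \<Longrightarrow> \<alpha> + \<beta> \<in> expos"
  and expos_diff [simp]: "\<alpha> \<in> expos \<Longrightarrow> \<alpha> - \<beta> \<in> expos"
  and expos_0 [simp]: "0 \<in> expos"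
  and expos_upd [simp]: "\<alpha> \<in> expos \<Longrightarrow> j < n \<Longrightarrow> \<alpha>(j := k) \<in> expos"
  and expos_bump [simp]: "\<alpha> \<in> expos \<Longrightarrow> j < n \<Longrightarrow> bump j \<alpha> \<in> expos"
  by (auto simp: expos_def bump_def)

lemma tdeg_add [simp]: "tdeg (\<alpha> + \<beta>) = tdeg \<alpha> + tdeg \<beta>"
  by (simp add: tdeg_def sum.distrib)

lemma tdeg_0 [simp]: "tdeg 0 = 0"
  by (simp add: tdeg_def)

lemma tdeg_bump [simp]: "j < n \<Longrightarrow> tdeg (bump j \<alpha>) = Suc (tdeg \<alpha>)"
  by (simp add: tdeg_def bump_apply sum.remove[of "{..<n}" j])

lemma bump_add: "bump j \<alpha> + \<beta> = bump j (\<alpha> + \<beta>)"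
  by (auto simp: bump_apply fun_eq_iff)

lemma mon_0 [simp]: "mon 0 = 1"
proof -
  have "prod_list (map (\<lambda>i. x i ^ 0) l) = 1" for l :: "nat list" by (induction l) auto
  then show ?thesis by (simp add: mon_def)
qed

lemma upt_split: "j < n \<Longrightarrow> [0..<n] = [0..<j] @ j # [Suc j..<n]"
  by (metis upt_add_eq_append le_add_diff_inverse less_imp_le_nat upt_conv_Cons zero_le)

text \<open>
  Exponents are built up by multiplying with variables from the left.  No reordering is needed
  as long as the new variable comes before or equals all variables present.
\<close>

lemma mon_bump:
  assumes "j < n" "\<forall>k<j. \<alpha> k = 0"
  shows "mon (bump j \<alpha>) = x j * mon \<alpha>"
proof -
  have a: "prod_list (map (\<lambda>i. x i ^ \<beta> i) [0..<j]) = 1" if "\<forall>k<j. \<beta> k = 0" for \<beta> :: expo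
  proof -
    have "map (\<lambda>i. x i ^ \<beta> i) [0..<j] = map (\<lambda>i. 1) [0..<j]" using that by (intro map_cong) auto
    moreover have "prod_list (map (\<lambda>i. 1::'a) l) = 1" for l :: "nat list" by (induction l) auto
    ultimately show ?thesis by (simp only:)
  qed
  have b: "map (\<lambda>i. x i ^ (bump j \<alpha>) i) [Suc j..<n] = map (\<lambda>i. x i ^ \<alpha> i) [Suc j..<n]"
    by (intro map_cong) (auto simp: bump_apply)
  have c: "prod_list (map (\<lambda>i. x i ^ (bump j \<alpha>) i) [0..<j]) = 1"
    by (rule a) (use assms in \<open>auto simp: bump_apply\<close>)
  show ?thesis
    unfolding mon_def upt_split[OF assms(1)] map_append prod_list.append list.map prod_list.Cons b c
      a[OF assms(2)]
    by (simp add: bump_apply mult.assoc)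
qed

lemma sigma_pow_0 [simp]: "sigma_pow 0 r = r"
proof -
  have "foldr (\<lambda>i. sigma i ^^ 0) l r = r" for l by (induction l) auto
  then show ?thesis by (simp add: sigma_pow_def)
qed

lemma sigma_pow_bump:
  assumes "j < n" "\<forall>k<j. \<alpha> k = 0"
  shows "sigma_pow (bump j \<alpha>) r = sigma j (sigma_pow \<alpha> r)"
proof -
  have a: "foldr (\<lambda>i. sigma i ^^ \<beta> i) [0..<j] s = s" if "\<forall>k<j. \<beta> k = 0" for \<beta> s
  proof -
    have "foldr (\<lambda>i. sigma i ^^ \<beta> i) [0..<j] s = foldr (\<lambda>i. id) [0..<j] s"
      using that by (intro foldr_cong) auto
    moreover have "foldr (\<lambda>i. id) l s = s" for l :: "nat list" by (induction l) auto
    ultimately show ?thesis by simp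
  qed
  have b: "foldr (\<lambda>i. sigma i ^^ (bump j \<alpha>) i) [Suc j..<n] r
      = foldr (\<lambda>i. sigma i ^^ \<alpha> i) [Suc j..<n] r"
    by (intro foldr_cong) (auto simp: bump_apply)
  have c: "foldr (\<lambda>i. sigma i ^^ (bump j \<alpha>) i) [0..<j] s = s" for s
    by (rule a) (use assms in \<open>auto simp: bump_apply\<close>)
  show ?thesis
    unfolding sigma_pow_def upt_split[OF assms(1)] foldr_append foldr_Cons o_apply b c a[OF assms(2)]
    by (simp add: bump_apply)
qed

text \<open>
  Every non-zero exponent arises by \<open>bump\<close> at its least non-zero index.  This is the form of
  induction in which \<open>mon_bump\<close> and \<open>sigma_pow_bump\<close> apply.
\<close>

lemma expo_induct [consumes 1, case_names zero bump]:
  assumes "\<alpha> \<in> expos" "P 0"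
    "\<And>\<alpha> j. \<alpha> \<in> expos \<Longrightarrow> j < n \<Longrightarrow> \<forall>k<j. \<alpha> k = 0 \<Longrightarrow> P \<alpha> \<Longrightarrow> P (bump j \<alpha>)"
  shows "P \<alpha>"
  using assms(1)
proof (induction "tdeg \<alpha>" arbitrary: \<alpha> rule: less_induct)
  case less
  show ?case
  proof (cases "\<alpha> = 0")
    case True then show ?thesis using assms(2) by simp
  next
    case False
    define j where "j = (LEAST j. \<alpha> j \<noteq> 0)"
    have "\<exists>j. \<alpha> j \<noteq> 0" using False by (simp add: fun_eq_iff)
    then have j: "\<alpha> j \<noteq> 0" unfolding j_def by (rule LeastI_ex)
    have jl: "\<forall>k<j. \<alpha> k = 0" unfolding j_def by (auto dest: not_less_Least)
    have jn: "j < n" using j less.prems by (metis (mono_tags, lifting) expos_def mem_Collect_eq not_le)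
    define \<beta> where "\<beta> = \<alpha>(j := \<alpha> j - 1)"
    have e: "\<alpha> = bump j \<beta>" using j by (auto simp: \<beta>_def bump_def)
    have b: "\<beta> \<in> expos" "\<forall>k<j. \<beta> k = 0" using less.prems jn jl by (auto simp: \<beta>_def)
    have "tdeg \<beta> < tdeg \<alpha>" using tdeg_bump[OF jn, of \<beta>] e by simp
    then have "P \<beta>" using less.hyps b by simp
    then show ?thesis using assms(3)[OF b(1) jn b(2)] e by simp
  qed
qed

lemma mon_single: "j < n \<Longrightarrow> mon (bump j 0) = x j"
  using mon_bump[of j 0] by simp

section \<open>The coefficient endomorphisms\<close>

lemma sigma_ex: assumes "i < n" "r \<in> R" shows "\<exists>s. s \<in> R \<and> x i * r - s * x i \<in> R"
proof (cases "r = 0")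
  case True then show ?thesis by (intro exI[of _ 0]) auto
next
  case False then show ?thesis using assms skew unfolding skew_pbw_def by blast
qed

text \<open>
  The difference of two candidates multiplies \<open>x\<^sub>i\<close> into \<open>R\<close>, but \<open>1\<close> and \<open>x\<^sub>i\<close> are different basis elements.
\<close>

lemma sigma_uniq:
  assumes "i < n" "r \<in> R" "s \<in> R" "x i * r - s * x i \<in> R" "t \<in> R" "x i * r - t * x i \<in> R"
  shows "s = t"
proof -
  let ?e = "bump i 0 :: expo"
  have e: "?e \<in> expos" "?e \<noteq> 0" using assms(1) by (auto simp: fun_eq_iff bump_def)
  have "(s - t) * x i \<in> R"
    using R_closed(6)[OF assms(6,4)] by (simp add: algebra_simps)
  then have "coeffs (((s - t) * x i) * mon 0) ?e = 0"
    using e by (subst coeffs_term) auto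
  moreover have "coeffs ((s - t) * mon ?e) ?e = s - t"
    using e assms by (subst coeffs_term) auto
  ultimately show ?thesis using mon_single[OF assms(1)] by simp
qed

lemma sigma_R: "i < n \<Longrightarrow> r \<in> R \<Longrightarrow> sigma i r \<in> R"
  and sigma_delta: "i < n \<Longrightarrow> r \<in> R \<Longrightarrow> x i * r - sigma i r * x i \<in> R"
proof -
  assume "i < n" "r \<in> R"
  then have "\<exists>!s. s \<in> R \<and> x i * r - s * x i \<in> R" using sigma_ex sigma_uniq by metis
  from theI'[OF this] show "sigma i r \<in> R" "x i * r - sigma i r * x i \<in> R"
    unfolding sigma_def by auto
qed

lemma sigma_eqI: "i < n \<Longrightarrow> r \<in> R \<Longrightarrow> s \<in> R \<Longrightarrow> x i * r - s * x i \<in> R \<Longrightarrow> sigma i r = s"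
  using sigma_uniq sigma_R sigma_delta by blast

lemma sigma_add:
  assumes "i < n" "r \<in> R" "s \<in> R" shows "sigma i (r + s) = sigma i r + sigma i s"
proof (rule sigma_eqI)
  show "x i * (r + s) - (sigma i r + sigma i s) * x i \<in> R"
    using R_closed(4)[OF sigma_delta[OF assms(1,2)] sigma_delta[OF assms(1,3)]]
    by (simp add: algebra_simps)
qed (use assms sigma_R in auto)

lemma sigma_mult:
  assumes "i < n" "r \<in> R" "s \<in> R" shows "sigma i (r * s) = sigma i r * sigma i s"
proof (rule sigma_eqI)
  have "x i * (r * s) - (sigma i r * sigma i s) * x i =
     (x i * r - sigma i r * x i) * s + sigma i r * (x i * s - sigma i s * x i)"
    by (simp add: algebra_simps)
  then show "x i * (r * s) - (sigma i r * sigma i s) * x i \<in> R"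
    using assms sigma_R sigma_delta by simp
qed (use assms sigma_R in auto)

lemma sigma_1: "i < n \<Longrightarrow> sigma i 1 = 1"
  by (rule sigma_eqI) auto

lemma sigma_runit: assumes "i < n" "runit u" shows "runit (sigma i u)"
proof -
  obtain v where "v \<in> R" "u * v = 1" "v * u = 1" "u \<in> R" using assms unfolding runit_def by auto
  then have "sigma i u * sigma i v = 1" "sigma i v * sigma i u = 1"
    using sigma_mult[OF assms(1), of u v] sigma_mult[OF assms(1), of v u] sigma_1[OF assms(1)] by auto
  then show ?thesis using sigma_R \<open>u \<in> R\<close> \<open>v \<in> R\<close> assms(1) unfolding runit_def by metis
qed

lemma sigma_pow_R: "\<alpha> \<in> expos \<Longrightarrow> r \<in> R \<Longrightarrow> sigma_pow \<alpha> r \<in> R"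
  by (induction \<alpha> rule: expo_induct) (auto simp: sigma_pow_bump sigma_R)

lemma sigma_pow_add:
  "\<alpha> \<in> expos \<Longrightarrow> r \<in> R \<Longrightarrow> s \<in> R \<Longrightarrow> sigma_pow \<alpha> (r + s) = sigma_pow \<alpha> r + sigma_pow \<alpha> s"
  by (induction \<alpha> rule: expo_induct) (auto simp: sigma_pow_bump sigma_add sigma_pow_R)

lemma sigma_pow_mult:
  "\<alpha> \<in> expos \<Longrightarrow> r \<in> R \<Longrightarrow> s \<in> R \<Longrightarrow> sigma_pow \<alpha> (r * s) = sigma_pow \<alpha> r * sigma_pow \<alpha> s"
  by (induction \<alpha> rule: expo_induct) (auto simp: sigma_pow_bump sigma_mult sigma_pow_R)

lemma sigma_pow_zero: "\<alpha> \<in> expos \<Longrightarrow> sigma_pow \<alpha> 0 = 0"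
  using sigma_pow_add[of \<alpha> 0 0] by simp

lemma sigma_pow_bij: "\<alpha> \<in> expos \<Longrightarrow> bij_betw (sigma_pow \<alpha>) R R"
proof (induction \<alpha> rule: expo_induct)
  case zero
  have "sigma_pow 0 = id" by (auto simp: fun_eq_iff)
  then show ?case using bij_betw_id[of R] by (simp add: id_def flip: zero_fun_def)
next
  case (bump \<alpha> j)
  have "bij_betw (sigma j) R R" using bijective bump by (simp add: bijective_skew_pbw_def)
  from bij_betw_trans[OF bump.IH this] show ?case
    using bump.hyps by (auto simp: sigma_pow_bump o_def fun_eq_iff cong: bij_betw_cong)
qed

lemma sigma_pow_eq_0: assumes "\<alpha> \<in> expos" "r \<in> R" "sigma_pow \<alpha> r = 0" shows "r = 0"
  using sigma_pow_bij[OF assms(1)] assms sigma_pow_zero[of \<alpha>] R_closed(1)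
  unfolding bij_betw_def inj_on_def by metis

lemma sigma_pow_surj: assumes "\<alpha> \<in> expos" "s \<in> R" obtains r where "r \<in> R" "sigma_pow \<alpha> r = s"
  using sigma_pow_bij[OF assms(1)] assms(2) that unfolding bij_betw_def by (metis imageE)

section \<open>Products modulo lower degree\<close>

definition lowdeg :: "nat \<Rightarrow> 'a set" where
  "lowdeg d = {f. \<forall>\<alpha>\<in>supp f. tdeg \<alpha> < d}"

lemma lowdegI: "(\<And>\<alpha>. coeffs f \<alpha> \<noteq> 0 \<Longrightarrow> tdeg \<alpha> < d) \<Longrightarrow> f \<in> lowdeg d"
  by (auto simp: lowdeg_def supp_iff)

lemma lowdegD: "f \<in> lowdeg d \<Longrightarrow> d \<le> tdeg \<alpha> \<Longrightarrow> coeffs f \<alpha> = 0"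
  by (auto simp: lowdeg_def supp_iff not_less[symmetric])

lemma lowdeg_0 [simp]: "0 \<in> lowdeg d"
  by (rule lowdegI) auto

lemma lowdeg_add: "f \<in> lowdeg d \<Longrightarrow> g \<in> lowdeg d \<Longrightarrow> f + g \<in> lowdeg d"
  by (rule lowdegI, rule ccontr) (auto simp: coeffs_add not_less lowdegD)

lemma lowdeg_diff: "f \<in> lowdeg d \<Longrightarrow> g \<in> lowdeg d \<Longrightarrow> f - g \<in> lowdeg d"
  by (rule lowdegI, rule ccontr) (auto simp: coeffs_diff not_less lowdegD)

lemma lowdeg_lmult: "r \<in> R \<Longrightarrow> f \<in> lowdeg d \<Longrightarrow> r * f \<in> lowdeg d"
  by (rule lowdegI, rule ccontr) (auto simp: coeffs_lmult not_less lowdegD)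

lemma lowdeg_sum: "(\<And>i. i \<in> I \<Longrightarrow> f i \<in> lowdeg d) \<Longrightarrow> sum f I \<in> lowdeg d"
  by (induction I rule: infinite_finite_induct) (auto intro: lowdeg_add)

lemma lowdeg_mono: "f \<in> lowdeg d \<Longrightarrow> d \<le> e \<Longrightarrow> f \<in> lowdeg e"
  by (auto simp: lowdeg_def)

lemma lowdeg_term: "\<alpha> \<in> expos \<Longrightarrow> r \<in> R \<Longrightarrow> tdeg \<alpha> < d \<Longrightarrow> r * mon \<alpha> \<in> lowdeg d"
  by (rule lowdegI) (auto simp: coeffs_term split: if_splits)

lemma lowdeg_mon: "\<alpha> \<in> expos \<Longrightarrow> tdeg \<alpha> < d \<Longrightarrow> mon \<alpha> \<in> lowdeg d"
  using lowdeg_term[of \<alpha> 1] by simp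

text \<open>
  A coefficient is moved to the left of \<open>x\<^sub>i\<close> at the cost of a term that does not contain the extra
  variable, so it suffices to control products of \<open>x\<^sub>i\<close> with monomials.
\<close>

lemma var_lowdeg_if:
  assumes "i < n" "f \<in> lowdeg d"
    and "\<And>\<alpha>. \<alpha> \<in> expos \<Longrightarrow> tdeg \<alpha> < d \<Longrightarrow> x i * mon \<alpha> \<in> lowdeg (Suc d)"
  shows "x i * f \<in> lowdeg (Suc d)"
proof -
  have t: "x i * (coeffs f \<alpha> * mon \<alpha>) \<in> lowdeg (Suc d)" if "\<alpha> \<in> supp f" for \<alpha>
  proof -
    let ?r = "coeffs f \<alpha>"
    have a: "\<alpha> \<in> expos" "tdeg \<alpha> < d" using that assms(2) supp_expos by (auto simp: lowdeg_def)
    have "x i * (?r * mon \<alpha>) = sigma i ?r * (x i * mon \<alpha>) + (x i * ?r - sigma i ?r * x i) * mon \<alpha>"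
      by (simp add: algebra_simps)
    then show ?thesis
      using a assms sigma_R sigma_delta coeffs_R
      by (auto intro!: lowdeg_add lowdeg_lmult[OF _ assms(3)] lowdeg_term)
  qed
  have "x i * f = (\<Sum>\<alpha>\<in>supp f. x i * (coeffs f \<alpha> * mon \<alpha>))"
    using arg_cong[OF expand[of f], of "(*) (x i)"] by (simp add: sum_distrib_left)
  then show ?thesis using t by (auto intro: lowdeg_sum)
qed

text \<open>
  The basic commutation law, by induction on the degree.  If \<open>x\<^sub>i\<close> comes no later than the first variable
  \<open>x\<^sub>j\<close> of the monomial, the product is already standard.  Otherwise \<open>x\<^sub>i x\<^sub>j\<close> is exchanged for
  \<open>c x\<^sub>j x\<^sub>i\<close> plus an affine part; the induction hypothesis sorts \<open>x\<^sub>i\<close> into the rest of the monomial,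
  after which \<open>x\<^sub>j\<close> stands in front of variables that do not precede it.
\<close>

lemma var_mon:
  assumes "i < n" "\<alpha> \<in> expos"
  shows "\<exists>u. runit u \<and> x i * mon \<alpha> - u * mon (bump i \<alpha>) \<in> lowdeg (Suc (tdeg \<alpha>))"
  using assms
proof (induction "tdeg \<alpha>" arbitrary: \<alpha> i rule: less_induct)
  case less
  \<comment> \<open>By linearity, the induction hypothesis covers the multiplication of a variable
    with arbitrary elements of smaller degree.\<close>
  have IHlow: "x k * f \<in> lowdeg (Suc d)" if "k < n" "d \<le> tdeg \<alpha>" "f \<in> lowdeg d" for k d f
  proof (rule var_lowdeg_if[OF that(1,3)])
    fix \<beta> assume b: "\<beta> \<in> expos" "tdeg \<beta> < d"
    then have "tdeg \<beta> < tdeg \<alpha>" using that by simp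
    then obtain u where u: "runit u"
      "x k * mon \<beta> - u * mon (bump k \<beta>) \<in> lowdeg (Suc (tdeg \<beta>))"
      using less.hyps[of \<beta> k] \<open>k < n\<close> b(1) by blast
    have "u * mon (bump k \<beta>) \<in> lowdeg (Suc d)"
      using b that u by (intro lowdeg_term) (auto dest: runit_R)
    from lowdeg_add[OF lowdeg_mono[OF u(2)] this] b show "x k * mon \<beta> \<in> lowdeg (Suc d)" by simp
  qed
  show ?case
  proof (cases "\<forall>k<i. \<alpha> k = 0")
    case True
    then have "x i * mon \<alpha> = 1 * mon (bump i \<alpha>)" using mon_bump less.prems by simp
    then show ?thesis using runit_1 by (intro exI[of _ 1]) simp
  next
    case False
    define j where "j = (LEAST j. \<alpha> j \<noteq> 0)"
    obtain k where k: "k < i" "\<alpha> k \<noteq> 0" using False by auto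
    have j: "\<alpha> j \<noteq> 0" unfolding j_def using k(2) by (rule LeastI)
    have jl: "\<forall>k<j. \<alpha> k = 0" unfolding j_def by (auto dest: not_less_Least)
    have "j \<le> k" unfolding j_def using k(2) by (rule Least_le)
    then have ji: "j < i" and jn: "j < n" using k less.prems by auto
    define \<beta> where "\<beta> = \<alpha>(j := \<alpha> j - 1)"
    have e: "\<alpha> = bump j \<beta>" using j by (auto simp: \<beta>_def bump_def)
    have b: "\<beta> \<in> expos" "\<forall>k<j. \<beta> k = 0" using less.prems jn jl by (auto simp: \<beta>_def)
    have d: "tdeg \<alpha> = Suc (tdeg \<beta>)" using tdeg_bump[OF jn, of \<beta>] e by simp
    have m: "mon \<alpha> = x j * mon \<beta>" using mon_bump[OF jn b(2)] e by simp
    obtain c where c: "runit c" "x i * x j - c * x j * x i \<in> affine_part"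
      using bijective ji less.prems unfolding bijective_skew_pbw_def runit_def by blast
    then obtain a bb where aff: "a \<in> R" "\<forall>k<n. bb k \<in> R"
      "x i * x j - c * x j * x i = a + (\<Sum>k<n. bb k * x k)"
      unfolding affine_part_def by blast
    have affm: "(a + (\<Sum>k<n. bb k * x k)) * mon \<beta> \<in> lowdeg (Suc (tdeg \<alpha>))"
    proof -
      have "bb k * (x k * mon \<beta>) \<in> lowdeg (Suc (tdeg \<alpha>))" if "k < n" for k
        by (intro lowdeg_lmult IHlow[of k "tdeg \<alpha>"] lowdeg_mon) (use that aff b d in auto)
      then have "(\<Sum>k<n. bb k * (x k * mon \<beta>)) \<in> lowdeg (Suc (tdeg \<alpha>))"
        by (auto intro!: lowdeg_sum)
      moreover have "a * mon \<beta> \<in> lowdeg (Suc (tdeg \<alpha>))"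
        using aff b d by (auto intro: lowdeg_term)
      ultimately show ?thesis
        by (auto simp: distrib_right sum_distrib_right mult.assoc intro: lowdeg_add)
    qed
    let ?bi = "bump i \<beta>"
    obtain u where u: "runit u" "x i * mon \<beta> - u * mon ?bi \<in> lowdeg (Suc (tdeg \<beta>))"
      using less.hyps[of \<beta> i] d b less.prems by auto
    \<comment> \<open>The lower-order remainder left over after sorting \<open>x\<^sub>i\<close> into the tail of the monomial.\<close>
    define v where "v = x i * mon \<beta> - u * mon ?bi"
    have vl: "x j * v \<in> lowdeg (Suc (tdeg \<alpha>))"
      using IHlow[OF jn, of "tdeg \<alpha>" v] u(2) d by (simp add: v_def)
    have bi: "mon (bump i \<alpha>) = x j * mon ?bi"
    proof -
      have "bump i \<alpha> = bump j ?bi" using e ji by (auto simp: fun_eq_iff bump_apply)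
      then show ?thesis using mon_bump[OF jn, of ?bi] b ji by (simp add: bump_apply)
    qed
    let ?s = "sigma j u" and ?d = "x j * u - sigma j u * x j"
    have uR: "u \<in> R" "c \<in> R" using u c by (auto dest: runit_R)
    have dl: "?d * mon ?bi \<in> lowdeg (Suc (tdeg \<alpha>))"
      using sigma_delta[OF jn uR(1)] b less.prems d by (intro lowdeg_term) auto
    have "x i * mon \<alpha> = (x i * x j) * mon \<beta>" by (simp add: m mult.assoc)
    also have "x i * x j = c * x j * x i + (a + (\<Sum>k<n. bb k * x k))" using aff(3) by (simp add: algebra_simps)
    also have "\<dots> * mon \<beta> = c * (x j * (x i * mon \<beta>)) + (a + (\<Sum>k<n. bb k * x k)) * mon \<beta>"
      by (simp add: distrib_right mult.assoc)
    also have "x i * mon \<beta> = u * mon ?bi + v" by (simp add: v_def)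
    also have "x j * (u * mon ?bi + v) = ?s * (x j * mon ?bi) + ?d * mon ?bi + x j * v"
      by (simp add: algebra_simps)
    finally have "x i * mon \<alpha> - (c * ?s) * mon (bump i \<alpha>) =
        c * (?d * mon ?bi) + c * (x j * v) + (a + (\<Sum>k<n. bb k * x k)) * mon \<beta>"
      unfolding bi by (simp add: algebra_simps)
    also have "\<dots> \<in> lowdeg (Suc (tdeg \<alpha>))"
      by (intro lowdeg_add lowdeg_lmult affm dl vl uR)
    finally show ?thesis using runit_mult[OF c(1) sigma_runit[OF jn u(1)]] by blast
  qed
qed

lemma var_lowdeg: assumes "i < n" "f \<in> lowdeg d" shows "x i * f \<in> lowdeg (Suc d)"
proof (rule var_lowdeg_if[OF assms])
  fix \<beta> assume b: "\<beta> \<in> expos" "tdeg \<beta> < d"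
  obtain u where u: "runit u"
    "x i * mon \<beta> - u * mon (bump i \<beta>) \<in> lowdeg (Suc (tdeg \<beta>))"
    using var_mon b assms by blast
  have "u * mon (bump i \<beta>) \<in> lowdeg (Suc d)"
    using b assms u by (intro lowdeg_term) (auto dest: runit_R)
  from lowdeg_add[OF lowdeg_mono[OF u(2)] this] b show "x i * mon \<beta> \<in> lowdeg (Suc d)" by simp
qed

lemma mon_lowdeg: "\<alpha> \<in> expos \<Longrightarrow> f \<in> lowdeg d \<Longrightarrow> mon \<alpha> * f \<in> lowdeg (tdeg \<alpha> + d)"
proof (induction \<alpha> rule: expo_induct)
  case (bump \<alpha> j)
  then show ?case using var_lowdeg[of j "mon \<alpha> * f"] by (simp add: mon_bump mult.assoc)
qed simp

text \<open>
  Pushing a coefficient past a monomial, one variable at a time: each \<open>\<delta>\<^sub>i\<close> only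
  contributes a term of lower degree.
\<close>

lemma mon_scalar:
  assumes "\<alpha> \<in> expos" "r \<in> R"
  shows "mon \<alpha> * r - sigma_pow \<alpha> r * mon \<alpha> \<in> lowdeg (tdeg \<alpha>)"
  using assms
proof (induction \<alpha> rule: expo_induct)
  case (bump \<alpha> j)
  let ?s = "sigma_pow \<alpha> r"
  have s: "?s \<in> R" using bump sigma_pow_R by simp
  have "mon (bump j \<alpha>) * r - sigma_pow (bump j \<alpha>) r * mon (bump j \<alpha>)
     = x j * (mon \<alpha> * r - ?s * mon \<alpha>) + (x j * ?s - sigma j ?s * x j) * mon \<alpha>"
    using bump.hyps by (simp add: mon_bump sigma_pow_bump algebra_simps)
  also have "\<dots> \<in> lowdeg (Suc (tdeg \<alpha>))"
    using bump s sigma_delta by (intro lowdeg_add var_lowdeg lowdeg_term) auto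
  finally show ?case using bump.hyps by simp
qed simp

lemma lowdeg_rscalar:
  assumes "f \<in> lowdeg d" "r \<in> R"
  shows "f * r \<in> lowdeg d"
proof -
  have "coeffs f \<gamma> * mon \<gamma> * r \<in> lowdeg d" if "\<gamma> \<in> supp f" for \<gamma>
  proof -
    have g: "\<gamma> \<in> expos" "tdeg \<gamma> < d" using that assms supp_expos by (auto simp: lowdeg_def)
    have "mon \<gamma> * r = (mon \<gamma> * r - sigma_pow \<gamma> r * mon \<gamma>) + sigma_pow \<gamma> r * mon \<gamma>" by simp
    also have "\<dots> \<in> lowdeg d"
      using g assms sigma_pow_R lowdeg_mono[OF mon_scalar[OF g(1) assms(2)]]
      by (intro lowdeg_add lowdeg_term) auto
    finally show ?thesis using coeffs_R by (simp add: mult.assoc lowdeg_lmult)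
  qed
  then have "(\<Sum>\<gamma>\<in>supp f. coeffs f \<gamma> * mon \<gamma> * r) \<in> lowdeg d" by (rule lowdeg_sum)
  then show ?thesis using arg_cong[OF expand[of f], of "\<lambda>f. f * r"] by (simp add: sum_distrib_right)
qed

lemma mon_mon:
  assumes "\<alpha> \<in> expos" "\<beta> \<in> expos"
  shows "\<exists>u. runit u \<and> mon \<alpha> * mon \<beta> - u * mon (\<alpha> + \<beta>) \<in> lowdeg (tdeg (\<alpha> + \<beta>))"
  using assms
proof (induction \<alpha> rule: expo_induct)
  case zero then show ?case using runit_1 by (intro exI[of _ 1]) (simp flip: zero_fun_def)
next
  case (bump \<alpha> j)
  obtain u where u: "runit u" "mon \<alpha> * mon \<beta> - u * mon (\<alpha> + \<beta>) \<in> lowdeg (tdeg (\<alpha> + \<beta>))"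
    using bump.IH[OF bump.prems] by blast
  have ab: "\<alpha> + \<beta> \<in> expos" using bump by auto
  let ?b = "bump j (\<alpha> + \<beta>)"
  obtain w where w: "runit w" "x j * mon (\<alpha> + \<beta>) - w * mon ?b \<in> lowdeg (Suc (tdeg (\<alpha> + \<beta>)))"
    using var_mon[OF _ ab] bump by blast
  have uR: "u \<in> R" using u by (simp add: runit_R)
  have "mon (bump j \<alpha>) * mon \<beta> - (sigma j u * w) * mon ?b =
      x j * (mon \<alpha> * mon \<beta> - u * mon (\<alpha> + \<beta>)) + (x j * u - sigma j u * x j) * mon (\<alpha> + \<beta>)
      + sigma j u * (x j * mon (\<alpha> + \<beta>) - w * mon ?b)"
    using bump.hyps by (simp add: mon_bump algebra_simps)
  also have "\<dots> \<in> lowdeg (Suc (tdeg (\<alpha> + \<beta>)))"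
    using bump.hyps u w uR ab sigma_delta sigma_R
    by (intro lowdeg_add var_lowdeg lowdeg_term lowdeg_lmult) auto
  finally show ?case
    unfolding bump_add tdeg_bump[OF bump.hyps(2)]
    using runit_mult[OF sigma_runit[OF bump.hyps(2) u(1)] w(1)] by blast
qed

lemma lowdeg_deg: "f \<in> lowdeg d \<longleftrightarrow> f = 0 \<or> deg f < d"
proof (cases "f = 0")
  case False
  then have "supp f \<noteq> {}" using expand[of f] by auto
  then show ?thesis using False finite_supp by (auto simp: lowdeg_def deg_def)
qed simp

lemma
  assumes "\<alpha> \<in> expos" "\<beta> \<in> expos"
  shows cmul_runit: "runit (cmul \<alpha> \<beta>)"
    and cmul_mon: "mon \<alpha> * mon \<beta> - cmul \<alpha> \<beta> * mon (\<alpha> + \<beta>) \<in> lowdeg (tdeg (\<alpha> + \<beta>))"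
proof -
  obtain u where u: "runit u" "mon \<alpha> * mon \<beta> - u * mon (\<alpha> + \<beta>) \<in> lowdeg (tdeg (\<alpha> + \<beta>))"
    using mon_mon assms by blast
  have ab: "\<alpha> + \<beta> \<in> expos" using assms by simp
  have "cmul \<alpha> \<beta> = u"
    unfolding cmul_def lowdeg_deg[symmetric]
  proof (rule the_equality)
    show "u \<in> R \<and> (\<exists>p. mon \<alpha> * mon \<beta> = u * mon (\<alpha> + \<beta>) + p \<and> p \<in> lowdeg (tdeg (\<alpha> + \<beta>)))"
      using u runit_R by (intro conjI exI[of _ "mon \<alpha> * mon \<beta> - u * mon (\<alpha> + \<beta>)"]) auto
    fix c assume "c \<in> R \<and> (\<exists>p. mon \<alpha> * mon \<beta> = c * mon (\<alpha> + \<beta>) + p \<and> p \<in> lowdeg (tdeg (\<alpha> + \<beta>)))"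
    then obtain p where c: "c \<in> R" "mon \<alpha> * mon \<beta> = c * mon (\<alpha> + \<beta>) + p" "p \<in> lowdeg (tdeg (\<alpha> + \<beta>))"
      by auto
    then have "coeffs (mon \<alpha> * mon \<beta> - u * mon (\<alpha> + \<beta>)) (\<alpha> + \<beta>) = c - u"
      using lowdegD[OF c(3), of "\<alpha> + \<beta>"] ab runit_R[OF u(1)]
      by (simp add: coeffs_add coeffs_diff coeffs_term)
    then show "c = u" using lowdegD[OF u(2), of "\<alpha> + \<beta>"] by simp
  qed
  then show "runit (cmul \<alpha> \<beta>)" "mon \<alpha> * mon \<beta> - cmul \<alpha> \<beta> * mon (\<alpha> + \<beta>) \<in> lowdeg (tdeg (\<alpha> + \<beta>))"
    using u by auto
qed

lemma mon_term:
  assumes "\<alpha> \<in> expos" "\<beta> \<in> expos" "r \<in> R"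
  shows "mon \<alpha> * (r * mon \<beta>) - (sigma_pow \<alpha> r * cmul \<alpha> \<beta>) * mon (\<alpha> + \<beta>) \<in> lowdeg (tdeg (\<alpha> + \<beta>))"
proof -
  have rR: "sigma_pow \<alpha> r \<in> R" using assms sigma_pow_R by simp
  have low: "f * mon \<beta> \<in> lowdeg (d + tdeg \<beta>)" if "f \<in> lowdeg d" for f d
  proof -
    have "(coeffs f \<gamma> * mon \<gamma>) * mon \<beta> \<in> lowdeg (d + tdeg \<beta>)" if g: "\<gamma> \<in> supp f" for \<gamma>
    proof -
      have ge: "\<gamma> \<in> expos" "tdeg \<gamma> < d" using g \<open>f \<in> lowdeg d\<close> supp_expos by (auto simp: lowdeg_def)
      have "mon \<beta> \<in> lowdeg (Suc (tdeg \<beta>))" using assms by (intro lowdeg_mon) auto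
      from mon_lowdeg[OF ge(1) this] have "mon \<gamma> * mon \<beta> \<in> lowdeg (d + tdeg \<beta>)"
        by (rule lowdeg_mono) (use ge in simp)
      then show ?thesis using coeffs_R by (simp add: mult.assoc lowdeg_lmult)
    qed
    then have "(\<Sum>\<gamma>\<in>supp f. coeffs f \<gamma> * mon \<gamma> * mon \<beta>) \<in> lowdeg (d + tdeg \<beta>)" by (rule lowdeg_sum)
    then show ?thesis using arg_cong[OF expand[of f], of "\<lambda>f. f * mon \<beta>"] by (simp add: sum_distrib_right)
  qed
  have "mon \<alpha> * (r * mon \<beta>) - (sigma_pow \<alpha> r * cmul \<alpha> \<beta>) * mon (\<alpha> + \<beta>) =
     (mon \<alpha> * r - sigma_pow \<alpha> r * mon \<alpha>) * mon \<beta>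
     + sigma_pow \<alpha> r * (mon \<alpha> * mon \<beta> - cmul \<alpha> \<beta> * mon (\<alpha> + \<beta>))"
    by (simp add: algebra_simps)
  also have "\<dots> \<in> lowdeg (tdeg (\<alpha> + \<beta>))"
    using low[OF mon_scalar[OF assms(1,3)]] lowdeg_lmult[OF rR cmul_mon[OF assms(1,2)]]
    by (auto intro: lowdeg_add)
  finally show ?thesis .
qed

lemma coeffs_mon_term:
  assumes "\<alpha> \<in> expos" "\<beta> \<in> expos" "r \<in> R"
  shows "tdeg (\<alpha> + \<beta>) \<le> tdeg \<gamma> \<Longrightarrow> coeffs (mon \<alpha> * (r * mon \<beta>)) \<gamma>
    = (if \<gamma> = \<alpha> + \<beta> then sigma_pow \<alpha> r * cmul \<alpha> \<beta> else 0)"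
proof -
  assume "tdeg (\<alpha> + \<beta>) \<le> tdeg \<gamma>"
  then have "coeffs (mon \<alpha> * (r * mon \<beta>) - (sigma_pow \<alpha> r * cmul \<alpha> \<beta>) * mon (\<alpha> + \<beta>)) \<gamma> = 0"
    using lowdegD[OF mon_term[OF assms]] by blast
  then show ?thesis
    using assms sigma_pow_R runit_R[OF cmul_runit] by (auto simp: coeffs_diff coeffs_term)
qed

lemma mon_mult_expand: "mon \<alpha> * f = (\<Sum>\<beta>\<in>supp f. mon \<alpha> * (coeffs f \<beta> * mon \<beta>))"
  using arg_cong[OF expand[of f], of "(*) (mon \<alpha>)"] by (simp add: sum_distrib_left)

lemma supp_mon_mult:
  assumes "\<alpha> \<in> expos" "\<gamma> \<in> supp (mon \<alpha> * f)"
  obtains \<beta> where "\<beta> \<in> supp f" "\<gamma> = \<alpha> + \<beta> \<or> tdeg \<gamma> < tdeg (\<alpha> + \<beta>)"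
proof -
  have "(\<Sum>\<beta>\<in>supp f. coeffs (mon \<alpha> * (coeffs f \<beta> * mon \<beta>)) \<gamma>) \<noteq> 0"
    using assms(2) mon_mult_expand[of \<alpha> f] by (simp add: supp_iff coeffs_sum)
  then obtain \<beta> where b: "\<beta> \<in> supp f" "coeffs (mon \<alpha> * (coeffs f \<beta> * mon \<beta>)) \<gamma> \<noteq> 0"
    by (meson sum.not_neutral_contains_not_neutral)
  have "\<gamma> = \<alpha> + \<beta> \<or> tdeg \<gamma> < tdeg (\<alpha> + \<beta>)"
    using coeffs_mon_term[of \<alpha> \<beta> "coeffs f \<beta>" \<gamma>] b assms(1) supp_expos coeffs_R
    by (meson not_less subsetD)
  then show ?thesis using that b by blast
qed

text \<open>
  When \<open>\<beta>\<close> has maximal degree in the support, no other term of \<open>f\<close> can reach the exponent \<open>\<alpha> + \<beta>\<close>.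
\<close>

lemma coeffs_mon_mult:
  assumes "\<alpha> \<in> expos" "\<beta> \<in> expos" "\<And>\<gamma>. \<gamma> \<in> supp f \<Longrightarrow> tdeg \<gamma> \<le> tdeg \<beta>"
  shows "coeffs (mon \<alpha> * f) (\<alpha> + \<beta>) = sigma_pow \<alpha> (coeffs f \<beta>) * cmul \<alpha> \<beta>"
proof -
  have "coeffs (mon \<alpha> * f) (\<alpha> + \<beta>)
      = (\<Sum>\<gamma>\<in>supp f. if \<gamma> = \<beta> then sigma_pow \<alpha> (coeffs f \<beta>) * cmul \<alpha> \<beta> else 0)"
    unfolding mon_mult_expand[of \<alpha> f] coeffs_sum
  proof (rule sum.cong)
    fix \<gamma> assume g: "\<gamma> \<in> supp f"
    then show "coeffs (mon \<alpha> * (coeffs f \<gamma> * mon \<gamma>)) (\<alpha> + \<beta>)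
       = (if \<gamma> = \<beta> then sigma_pow \<alpha> (coeffs f \<beta>) * cmul \<alpha> \<beta> else 0)"
      using assms supp_expos coeffs_R by (subst coeffs_mon_term) auto
  qed simp
  also have "\<dots> = sigma_pow \<alpha> (coeffs f \<beta>) * cmul \<alpha> \<beta>"
    using finite_supp assms(1) sigma_pow_zero by (auto simp: supp_iff)
  finally show ?thesis .
qed

text \<open>
  The maps \<open>\<sigma>\<^sup>\<alpha>\<close> are not multiplicative in \<open>\<alpha>\<close>, but the defect is conjugation by a unit.  Both sides are the
  coefficient at \<open>x\<^sup>\<alpha>\<^sup>+\<^sup>\<beta>\<close> of \<open>x\<^sup>\<alpha> x\<^sup>\<beta> r\<close>, computed with the two bracketings.
\<close>

lemma sigma_pow_compose:
  assumes "\<alpha> \<in> expos" "\<beta> \<in> expos" "r \<in> R"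
  shows "sigma_pow \<alpha> (sigma_pow \<beta> r) * cmul \<alpha> \<beta> = cmul \<alpha> \<beta> * sigma_pow (\<alpha> + \<beta>) r"
proof -
  let ?s = "sigma_pow \<beta> r" and ?c = "cmul \<alpha> \<beta>" and ?t = "sigma_pow (\<alpha> + \<beta>) r"
  have ab: "\<alpha> + \<beta> \<in> expos" and s: "?s \<in> R" and c: "?c \<in> R" and t: "?t \<in> R"
    using assms sigma_pow_R runit_R[OF cmul_runit] by auto
  have l: "mon \<alpha> * (mon \<beta> * r - ?s * mon \<beta>) \<in> lowdeg (tdeg (\<alpha> + \<beta>))"
    using mon_lowdeg[OF assms(1) mon_scalar[OF assms(2,3)]] by simp
  have r: "(mon \<alpha> * mon \<beta> - ?c * mon (\<alpha> + \<beta>)) * r \<in> lowdeg (tdeg (\<alpha> + \<beta>))"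
    using lowdeg_rscalar[OF cmul_mon[OF assms(1,2)] assms(3)] .
  have "(sigma_pow \<alpha> ?s * ?c) * mon (\<alpha> + \<beta>) - (?c * ?t) * mon (\<alpha> + \<beta>) =
      (mon \<alpha> * mon \<beta> - ?c * mon (\<alpha> + \<beta>)) * r + ?c * (mon (\<alpha> + \<beta>) * r - ?t * mon (\<alpha> + \<beta>))
      - mon \<alpha> * (mon \<beta> * r - ?s * mon \<beta>)
      - (mon \<alpha> * (?s * mon \<beta>) - (sigma_pow \<alpha> ?s * ?c) * mon (\<alpha> + \<beta>))"
    by (simp add: algebra_simps)
  also have "\<dots> \<in> lowdeg (tdeg (\<alpha> + \<beta>))"
    by (intro lowdeg_diff lowdeg_add l r lowdeg_lmult c mon_scalar mon_term ab s assms)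
  finally have "coeffs ((sigma_pow \<alpha> ?s * ?c) * mon (\<alpha> + \<beta>) - (?c * ?t) * mon (\<alpha> + \<beta>)) (\<alpha> + \<beta>) = 0"
    by (rule lowdegD) simp
  then show ?thesis using ab s c t sigma_pow_R assms(1) by (simp add: coeffs_diff coeffs_term)
qed

end

section \<open>Monomial orders and leading monomials\<close>

text \<open>
  The order \<open>ordA\<close> of the ring enters only through the formula \<open>lm_ring_mon\<close>, which turns the
  axioms for \<open>ord\<close> into invariance under addition of exponents.
\<close>

locale bijective_pbw_module = bijective_pbw R n x + pbw_module R n x ord
  for R :: "'a::ring_1 set" and n x and ord :: "(expo \<times> 'm::finite) rel" +
  fixes ordA :: "expo rel"
  assumes ordA: "monomial_order ordA" and ordM: "monomial_order_vec ordA ord"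
begin

lemma lm_ring_mon:
  assumes "\<alpha> \<in> expos" "\<beta> \<in> expos"
  shows "lm_ring ordA (mon \<alpha> * mon \<beta>) = \<alpha> + \<beta>"
proof -
  have lin: "linear_order_on expos ordA"
    and dg: "\<And>\<alpha> \<beta>. \<alpha> \<in> expos \<Longrightarrow> \<beta> \<in> expos \<Longrightarrow> tdeg \<alpha> < tdeg \<beta> \<Longrightarrow> (\<alpha>, \<beta>) \<in> ordA"
    using ordA by (auto simp: monomial_order_def)
  have ab: "\<alpha> + \<beta> \<in> expos" using assms by simp
  have rf: "(\<alpha> + \<beta>, \<alpha> + \<beta>) \<in> ordA"
    using lin ab by (auto simp: linear_order_on_def partial_order_on_def preorder_on_def refl_on_def)
  have c: "cmul \<alpha> \<beta> \<noteq> 0" using cmul_runit[OF assms] by (auto simp: runit_def)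
  have co: "coeffs (mon \<alpha> * mon \<beta>) \<gamma> = (if \<gamma> = \<alpha> + \<beta> then cmul \<alpha> \<beta> else 0)"
    if "tdeg (\<alpha> + \<beta>) \<le> tdeg \<gamma>" for \<gamma>
    using lowdegD[OF cmul_mon[OF assms] that] ab runit_R[OF cmul_runit[OF assms]]
    by (auto simp: coeffs_diff coeffs_term)
  show ?thesis unfolding lm_ring_def
  proof (rule max_wrt_eqI[OF lin])
    show "\<alpha> + \<beta> \<in> supp (mon \<alpha> * mon \<beta>)" using co[of "\<alpha> + \<beta>"] c by (simp add: supp_iff)
    fix \<gamma> assume g: "\<gamma> \<in> supp (mon \<alpha> * mon \<beta>)"
    then have "\<gamma> \<in> expos" using supp_expos by auto
    show "(\<gamma>, \<alpha> + \<beta>) \<in> ordA"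
    proof (cases "tdeg \<gamma> < tdeg (\<alpha> + \<beta>)")
      case True then show ?thesis using dg \<open>\<gamma> \<in> expos\<close> ab by blast
    next
      case False
      then have "\<gamma> = \<alpha> + \<beta>" using co[of \<gamma>] g by (auto simp: supp_iff split: if_splits)
      then show ?thesis using rf by simp
    qed
  qed
qed

section \<open>Initial segments of the monomial order\<close>

definition down :: "expo \<times> 'm \<Rightarrow> (expo \<times> 'm) set" where
  "down X = {Y. (Y, X) \<in> ord}"

definition sdown :: "expo \<times> 'm \<Rightarrow> (expo \<times> 'm) set" where
  "sdown X = {Y. (Y, X) \<in> ord \<and> Y \<noteq> X}"

lemma ord_lin: "linear_order_on (expos \<times> UNIV) ord"
  using ordM by (simp add: monomial_order_vec_def)

lemma ord_refl: "fst X \<in> expos \<Longrightarrow> X \<in> down X"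
  using ord_lin unfolding down_def linear_order_on_def partial_order_on_def preorder_on_def refl_on_def
  by (cases X) auto

lemma ord_antisym: "X \<in> down Y \<Longrightarrow> Y \<in> down X \<Longrightarrow> X = Y"
  using ord_lin unfolding down_def linear_order_on_def partial_order_on_def
  by (metis antisymD mem_Collect_eq)

lemma down_trans: "X \<in> down Y \<Longrightarrow> Y \<in> down Z \<Longrightarrow> X \<in> down Z"
  using ord_lin unfolding down_def linear_order_on_def partial_order_on_def preorder_on_def
  by (metis mem_Collect_eq transD)

lemma down_total: "fst X \<in> expos \<Longrightarrow> fst Y \<in> expos \<Longrightarrow> X \<in> sdown Y \<or> X = Y \<or> Y \<in> sdown X"
  using ord_lin unfolding sdown_def linear_order_on_def total_on_def by (cases X; cases Y) auto

lemma down_expos: "X \<in> down Y \<Longrightarrow> fst X \<in> expos \<and> fst Y \<in> expos"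
  using ord_lin
  unfolding down_def linear_order_on_def partial_order_on_def preorder_on_def refl_on_def
  by (cases X; cases Y) auto

lemma sdown_down: "X \<in> sdown Y \<Longrightarrow> X \<in> down Y"
  by (auto simp: down_def sdown_def)

lemma down_iff: "X \<in> down Y \<longleftrightarrow> X \<in> sdown Y \<or> (X = Y \<and> fst Y \<in> expos)"
  using ord_refl[of Y] down_expos[of X Y] by (auto simp: down_def sdown_def)

lemma sdown_trans: "X \<in> down Y \<Longrightarrow> Y \<in> sdown Z \<Longrightarrow> X \<in> sdown Z"
  using down_trans[of X Y Z] ord_antisym[of X Y] by (auto simp: down_def sdown_def)

lemma sdown_trans': "X \<in> sdown Y \<Longrightarrow> Y \<in> down Z \<Longrightarrow> X \<in> sdown Z"
  using down_trans[of X Y Z] ord_antisym[of X Y] by (auto simp: down_def sdown_def)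

lemma sdown_deg:
  assumes "\<alpha> \<in> expos" "\<beta> \<in> expos" "tdeg \<alpha> < tdeg \<beta>" shows "(\<alpha>, i) \<in> sdown (\<beta>, j)"
  using ordM assms by (auto simp: sdown_def monomial_order_vec_def)

lemma down_deg: assumes "(\<alpha>, i) \<in> down (\<beta>, j)" shows "tdeg \<alpha> \<le> tdeg \<beta>"
proof (rule ccontr)
  assume n: "\<not> ?thesis"
  have e: "\<alpha> \<in> expos" "\<beta> \<in> expos" using down_expos[OF assms] by auto
  then have "(\<beta>, j) \<in> sdown (\<alpha>, i)" using sdown_deg n by simp
  then have "(\<alpha>, i) = (\<beta>, j)" using ord_antisym sdown_down assms by blast
  then show False using n by simp
qed

lemma down_shift: assumes "(\<alpha>, i) \<in> down (\<beta>, j)" "\<gamma> \<in> expos" shows "(\<gamma> + \<alpha>, i) \<in> down (\<gamma> + \<beta>, j)"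
proof -
  have e: "\<alpha> \<in> expos" "\<beta> \<in> expos" using down_expos[OF assms(1)] by auto
  have "((lm_ring ordA (mon \<gamma> * mon \<alpha>), i), (lm_ring ordA (mon \<gamma> * mon \<beta>), j)) \<in> ord"
    using ordM assms unfolding monomial_order_vec_def down_def by blast
  then show ?thesis using e assms(2) by (simp add: lm_ring_mon down_def)
qed

lemma sdown_shift: assumes "(\<alpha>, i) \<in> sdown (\<beta>, j)" "\<gamma> \<in> expos" shows "(\<gamma> + \<alpha>, i) \<in> sdown (\<gamma> + \<beta>, j)"
  using down_shift[OF sdown_down[OF assms(1)] assms(2)] assms(1) by (auto simp: sdown_def down_def)

lemma finite_deg_le: "finite {\<alpha> \<in> expos. tdeg \<alpha> \<le> d}"
proof (rule finite_subset)
  show "finite {f :: expo. \<forall>i. (i \<in> {..<n} \<longrightarrow> f i \<in> {..d}) \<and> (i \<notin> {..<n} \<longrightarrow> f i = 0)}"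
    by (rule finite_set_of_finite_funs) auto
  have "\<alpha> i \<le> d" if "i < n" "tdeg \<alpha> \<le> d" for i \<alpha>
  proof -
    have "\<alpha> i \<le> (\<Sum>i<n. \<alpha> i)" using that by (intro member_le_sum) auto
    then show ?thesis using that by (simp add: tdeg_def)
  qed
  then show "{\<alpha> \<in> expos. tdeg \<alpha> \<le> d} \<subseteq>
     {f :: expo. \<forall>i. (i \<in> {..<n} \<longrightarrow> f i \<in> {..d}) \<and> (i \<notin> {..<n} \<longrightarrow> f i = 0)}"
    by (auto simp: expos_def)
qed

lemma finite_sdown: "finite (sdown X)"
proof (rule finite_subset)
  show "finite ({\<alpha> \<in> expos. tdeg \<alpha> \<le> tdeg (fst X)} \<times> (UNIV :: 'm set))"
    by (intro finite_cartesian_product finite_deg_le) simp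
  show "sdown X \<subseteq> {\<alpha> \<in> expos. tdeg \<alpha> \<le> tdeg (fst X)} \<times> (UNIV :: 'm set)"
  proof
    fix Y assume "Y \<in> sdown X"
    from sdown_down[OF this] show "Y \<in> {\<alpha> \<in> expos. tdeg \<alpha> \<le> tdeg (fst X)} \<times> (UNIV :: 'm set)"
      using down_deg[of "fst Y" "snd Y" "fst X" "snd X"] down_expos[of Y X] by (cases Y) auto
  qed
qed

text \<open>
  Only finitely many monomials have at most a given degree, so initial segments are finite.
\<close>

lemma wf_sdown: "wf {(Y, X). Y \<in> sdown X}"
proof (rule wf_subset)
  show "wf (measure (\<lambda>X. card (sdown X)))" by simp
  show "{(Y, X). Y \<in> sdown X} \<subseteq> measure (\<lambda>X. card (sdown X))"
  proof clarsimp
    fix \<alpha> i \<beta> j assume a: "(\<alpha>, i) \<in> sdown (\<beta>, j)"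
    have "sdown (\<alpha>, i) \<subseteq> sdown (\<beta>, j)"
      using sdown_trans'[OF _ sdown_down[OF a]] by blast
    moreover have "(\<alpha>, i) \<notin> sdown (\<alpha>, i)" by (simp add: sdown_def)
    ultimately have "sdown (\<alpha>, i) \<subset> sdown (\<beta>, j)" using a by blast
    then show "card (sdown (\<alpha>, i)) < card (sdown (\<beta>, j))"
      using finite_sdown psubset_card_mono by blast
  qed
qed

section \<open>Leading terms of vectors\<close>

definition vcoeff :: "'a ^ 'm \<Rightarrow> expo \<times> 'm \<Rightarrow> 'a" where
  "vcoeff v X = coeffs (v $ snd X) (fst X)"

definition vsupp :: "'a ^ 'm \<Rightarrow> (expo \<times> 'm) set" where
  "vsupp v = {X. vcoeff v X \<noteq> 0}"

lemma vsupp_iff: "X \<in> vsupp v \<longleftrightarrow> vcoeff v X \<noteq> 0" by (simp add: vsupp_def)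

lemma vsupp_supp: "(\<alpha>, i) \<in> vsupp v \<longleftrightarrow> \<alpha> \<in> supp (v $ i)"
  by (simp add: vsupp_iff vcoeff_def supp_iff)

lemma vsupp_expos: "X \<in> vsupp v \<Longrightarrow> fst X \<in> expos"
  using supp_expos by (cases X) (auto simp: vsupp_supp)

lemma finite_vsupp: "finite (vsupp v)"
proof (rule finite_subset)
  show "vsupp v \<subseteq> (\<Union>i. supp (v $ i) \<times> {i})" by (auto simp: vsupp_supp)
qed (simp add: finite_supp)

lemma vcoeff_R: "vcoeff v X \<in> R" by (simp add: vcoeff_def coeffs_R)

lemma vcoeff_add: "vcoeff (u + v) X = vcoeff u X + vcoeff v X"
  and vcoeff_diff: "vcoeff (u - v) X = vcoeff u X - vcoeff v X"
  and vcoeff_0: "vcoeff 0 X = 0"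
  by (simp_all add: vcoeff_def coeffs_add coeffs_diff)

lemma vcoeff_lmult: "r \<in> R \<Longrightarrow> vcoeff (r *s v) X = r * vcoeff v X"
  by (simp add: vcoeff_def coeffs_lmult)

lemma vcoeff_sum: "vcoeff (sum f I) X = (\<Sum>i\<in>I. vcoeff (f i) X)"
  by (simp add: vcoeff_def coeffs_sum)

lemma vec_eq_0: "vsupp v = {} \<Longrightarrow> v = 0"
proof -
  assume a: "vsupp v = {}"
  have "coeffs (v $ i) \<alpha> = 0" for i \<alpha>
    using a vsupp_iff[of "(\<alpha>, i)" v] by (simp add: vcoeff_def)
  then have "v $ i = 0" for i by (rule coeffs_eq_0)
  then show "v = 0" by (simp add: vec_eq_iff)
qed

lemma lm_alt: "lm v = max_wrt ord (vsupp v)"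
  unfolding lm_def vsupp_def vcoeff_def by (rule arg_cong[where f = "max_wrt ord"]) auto

lemma lm_eq: "lm v = (lexpo v, lind v)"
  by (simp add: lexpo_def lind_def)

lemma lc_eq: "lc v = vcoeff v (lm v)"
  by (simp add: lc_def vcoeff_def lexpo_def lind_def)

lemma lc_R: "lc v \<in> R" by (simp add: lc_eq vcoeff_R)

lemma
  assumes "v \<noteq> 0"
  shows lm_in: "lm v \<in> vsupp v" and lm_max: "vsupp v \<subseteq> down (lm v)"
proof -
  have "vsupp v \<noteq> {}" using assms vec_eq_0 by blast
  moreover have "vsupp v \<subseteq> expos \<times> UNIV" using vsupp_expos by (auto simp: mem_Times_iff)
  ultimately show "lm v \<in> vsupp v" "vsupp v \<subseteq> down (lm v)"
    unfolding lm_alt down_def using max_wrt_props[OF ord_lin finite_vsupp] by blast+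
qed

lemma lexpo_expos: "v \<noteq> 0 \<Longrightarrow> lexpo v \<in> expos"
  using vsupp_expos[OF lm_in] by (simp add: lexpo_def)

lemma vsupp_mon:
  assumes "\<gamma> \<in> expos" "(\<delta>, i) \<in> vsupp (mon \<gamma> *s v)"
  obtains \<beta> where "(\<beta>, i) \<in> vsupp v" "\<delta> = \<gamma> + \<beta> \<or> tdeg \<delta> < tdeg (\<gamma> + \<beta>)"
  using assms supp_mon_mult[OF assms(1), of \<delta> "v $ i"] by (auto simp: vsupp_supp)

lemma vsupp_mon_subset:
  assumes "\<gamma> \<in> expos" "vsupp v \<subseteq> down (\<beta>, i)"
  shows "vsupp (mon \<gamma> *s v) \<subseteq> down (\<gamma> + \<beta>, i)"
    and "vsupp v \<subseteq> sdown (\<beta>, i) \<Longrightarrow> vsupp (mon \<gamma> *s v) \<subseteq> sdown (\<gamma> + \<beta>, i)"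
proof -
  have key: "\<exists>\<beta>'. (\<beta>', j) \<in> vsupp v \<and> (\<delta>, j) \<in> down (\<gamma> + \<beta>', j)"
    if "(\<delta>, j) \<in> vsupp (mon \<gamma> *s v)" for \<delta> j
  proof -
    obtain \<beta>' where b: "(\<beta>', j) \<in> vsupp v" "\<delta> = \<gamma> + \<beta>' \<or> tdeg \<delta> < tdeg (\<gamma> + \<beta>')"
      using vsupp_mon[OF assms(1) \<open>(\<delta>, j) \<in> _\<close>] by blast
    have "\<delta> \<in> expos" "\<gamma> + \<beta>' \<in> expos" using vsupp_expos[OF that] vsupp_expos[OF b(1)] assms by auto
    then have "(\<delta>, j) \<in> down (\<gamma> + \<beta>', j)"
      using b(2) ord_refl[of "(\<gamma> + \<beta>', j)"] sdown_down[OF sdown_deg] by auto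
    then show ?thesis using b by blast
  qed
  show "vsupp (mon \<gamma> *s v) \<subseteq> down (\<gamma> + \<beta>, i)"
  proof (clarify)
    fix \<delta> j assume "(\<delta>, j) \<in> vsupp (mon \<gamma> *s v)"
    from key[OF this] show "(\<delta>, j) \<in> down (\<gamma> + \<beta>, i)"
      using down_shift[OF _ assms(1)] assms(2) down_trans by blast
  qed
  assume s: "vsupp v \<subseteq> sdown (\<beta>, i)"
  show "vsupp (mon \<gamma> *s v) \<subseteq> sdown (\<gamma> + \<beta>, i)"
  proof (clarify)
    fix \<delta> j assume "(\<delta>, j) \<in> vsupp (mon \<gamma> *s v)"
    from key[OF this] show "(\<delta>, j) \<in> sdown (\<gamma> + \<beta>, i)"
      using sdown_shift[OF _ assms(1)] s sdown_trans by blast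
  qed
qed

lemma vcoeff_mon:
  assumes "\<gamma> \<in> expos" "vsupp v \<subseteq> down (\<beta>, i)" "\<beta> \<in> expos"
  shows "vcoeff (mon \<gamma> *s v) (\<gamma> + \<beta>, i) = sigma_pow \<gamma> (vcoeff v (\<beta>, i)) * cmul \<gamma> \<beta>"
proof -
  have "tdeg \<delta> \<le> tdeg \<beta>" if "\<delta> \<in> supp (v $ i)" for \<delta>
    using that assms(2) down_deg by (auto simp: vsupp_supp[symmetric])
  then show ?thesis using coeffs_mon_mult[OF assms(1,3), of "v $ i"] by (simp add: vcoeff_def)
qed

lemma vcoeff_term:
  assumes "\<alpha> \<in> expos" "r \<in> R" "g \<noteq> 0"
  shows "vcoeff ((r * mon \<alpha>) *s g) (\<alpha> + lexpo g, lind g) = r * sigma_pow \<alpha> (lc g) * cmul \<alpha> (lexpo g)"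
  using vcoeff_mon[OF assms(1) lm_max[OF assms(3), unfolded lm_eq] lexpo_expos[OF assms(3)]]
  by (simp add: vector_smult_assoc[symmetric] vcoeff_lmult assms lc_eq[unfolded lm_eq] mult.assoc)

lemma vsupp_lmult: "r \<in> R \<Longrightarrow> vsupp (r *s v) \<subseteq> vsupp v"
  by (auto simp: vsupp_iff vcoeff_lmult)

lemma vsupp_term:
  assumes "\<alpha> \<in> expos" "r \<in> R" "g \<noteq> 0"
  shows "vsupp ((r * mon \<alpha>) *s g) \<subseteq> down (\<alpha> + lexpo g, lind g)"
  using vsupp_mon_subset(1)[OF assms(1) lm_max[OF assms(3), unfolded lm_eq]]
    vsupp_lmult[OF assms(2), of "mon \<alpha> *s g"]
  by (auto simp: vector_smult_assoc)

lemma vsupp_add: "vsupp u \<subseteq> Q \<Longrightarrow> vsupp v \<subseteq> Q \<Longrightarrow> vsupp (u + v) \<subseteq> Q"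
  by (fastforce simp: vsupp_iff vcoeff_add)

lemma vsupp_diff: "vsupp u \<subseteq> Q \<Longrightarrow> vsupp v \<subseteq> Q \<Longrightarrow> vsupp (u - v) \<subseteq> Q"
  by (fastforce simp: vsupp_iff vcoeff_diff)

lemma vsupp_0 [simp]: "vsupp 0 = {}" by (simp add: vsupp_def vcoeff_0)

lemma vsupp_sum: "(\<And>i. i \<in> I \<Longrightarrow> vsupp (f i) \<subseteq> Q) \<Longrightarrow> vsupp (sum f I) \<subseteq> Q"
  by (induction I rule: infinite_finite_induct) (auto simp: vsupp_add)

lemma sdown_of_zero: "vsupp v \<subseteq> down X \<Longrightarrow> vcoeff v X = 0 \<Longrightarrow> vsupp v \<subseteq> sdown X"
  by (auto simp: vsupp_iff down_iff)

section \<open>Sums of multiples of generators\<close>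

text \<open>
  The left \<open>R\<close>-span of the multiples \<open>x\<^sup>\<alpha> g\<close> with \<open>g \<in> G\<close> whose leading monomial lies in \<open>Q\<close>.  Bounding
  the leading monomials of the summands, rather than the leading monomial of their sum, is what
  distinguishes a standard representation from an arbitrary one.
\<close>

inductive_set tspan :: "('a ^ 'm) set \<Rightarrow> (expo \<times> 'm) set \<Rightarrow> ('a ^ 'm) set" for G Q where
  zero: "0 \<in> tspan G Q"
| add: "g \<in> G \<Longrightarrow> r \<in> R \<Longrightarrow> \<alpha> \<in> expos \<Longrightarrow> (\<alpha> + lexpo g, lind g) \<in> Q \<Longrightarrow> v \<in> tspan G Q
    \<Longrightarrow> (r * mon \<alpha>) *s g + v \<in> tspan G Q"

lemma tspan_mono: "v \<in> tspan G Q \<Longrightarrow> G \<subseteq> G' \<Longrightarrow> Q \<subseteq> Q' \<Longrightarrow> v \<in> tspan G' Q'"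
  by (induction rule: tspan.induct) (auto intro: tspan.intros)

lemma tspan_add: "u \<in> tspan G Q \<Longrightarrow> v \<in> tspan G Q \<Longrightarrow> u + v \<in> tspan G Q"
  by (induction rule: tspan.induct) (auto intro: tspan.intros simp: add.assoc)

lemma tspan_term:
  "g \<in> G \<Longrightarrow> r \<in> R \<Longrightarrow> \<alpha> \<in> expos \<Longrightarrow> (\<alpha> + lexpo g, lind g) \<in> Q \<Longrightarrow> (r * mon \<alpha>) *s g \<in> tspan G Q"
  using tspan.add[OF _ _ _ _ tspan.zero] by fastforce

lemma tspan_lmult: assumes "r \<in> R" "v \<in> tspan G Q" shows "r *s v \<in> tspan G Q"
  using assms(2)
proof (induction rule: tspan.induct)
  case zero then show ?case by (simp add: tspan.zero)
next
  case (add g s \<alpha> v)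
  have "r *s ((s * mon \<alpha>) *s g + v) = ((r * s) * mon \<alpha>) *s g + r *s v"
    by (simp add: vector_add_ldistrib vector_smult_assoc mult.assoc)
  then show ?case using add assms(1) by (auto intro!: tspan.add)
qed

lemma tspan_diff: "u \<in> tspan G Q \<Longrightarrow> v \<in> tspan G Q \<Longrightarrow> u - v \<in> tspan G Q"
  using tspan_add[of u G Q "(-1) *s v"] tspan_lmult[of "-1" v G Q]
  by (simp add: vec_eq_iff vector_sneg_minus1[symmetric])

lemma tspan_sum: "(\<And>i. i \<in> I \<Longrightarrow> f i \<in> tspan G Q) \<Longrightarrow> sum f I \<in> tspan G Q"
  by (induction I rule: infinite_finite_induct) (auto intro: tspan_add tspan.zero)

lemma sum_smult: "(\<Sum>i\<in>I. c i) *s (v :: 'a ^ 'm) = (\<Sum>i\<in>I. c i *s v)"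
  by (simp add: vec_eq_iff sum_distrib_right)

text \<open>
  An arbitrary ring element as coefficient of \<open>g\<close> is split along its monomials.
\<close>

lemma tspan_scalar:
  assumes "g \<in> G" "\<And>\<alpha>. \<alpha> \<in> supp p \<Longrightarrow> (\<alpha> + lexpo g, lind g) \<in> Q"
  shows "p *s g \<in> tspan G Q"
proof -
  have "p *s g = (\<Sum>\<alpha>\<in>supp p. (coeffs p \<alpha> * mon \<alpha>) *s g)"
    using arg_cong[OF expand[of p], of "\<lambda>p. p *s g"] by (simp add: sum_smult)
  also have "\<dots> \<in> tspan G Q"
    using assms supp_expos coeffs_R by (intro tspan_sum tspan_term) auto
  finally show ?thesis .
qed

lemma tspan_mon:
  assumes "\<gamma> \<in> expos" "v \<in> tspan G Q" "0 \<notin> G"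
    and "\<And>\<beta> i \<delta>. (\<beta>, i) \<in> Q \<Longrightarrow> \<beta> \<in> expos \<Longrightarrow> \<delta> \<in> expos \<Longrightarrow> \<delta> = \<gamma> + \<beta> \<or> tdeg \<delta> < tdeg (\<gamma> + \<beta>)
      \<Longrightarrow> (\<delta>, i) \<in> Q'"
  shows "mon \<gamma> *s v \<in> tspan G Q'"
  using assms(2)
proof (induction rule: tspan.induct)
  case zero then show ?case by (simp add: tspan.zero)
next
  case (add g r \<alpha> v)
  have g: "lexpo g \<in> expos" using add(1) assms(3) lexpo_expos by metis
  have "(mon \<gamma> * (r * mon \<alpha>)) *s g \<in> tspan G Q'"
  proof (rule tspan_scalar[OF add(1)])
    fix \<delta> assume d: "\<delta> \<in> supp (mon \<gamma> * (r * mon \<alpha>))"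
    obtain \<alpha>' where "\<alpha>' \<in> supp (r * mon \<alpha>)" "\<delta> = \<gamma> + \<alpha>' \<or> tdeg \<delta> < tdeg (\<gamma> + \<alpha>')"
      using supp_mon_mult[OF assms(1) d] by blast
    then have "\<delta> = \<gamma> + \<alpha> \<or> tdeg \<delta> < tdeg (\<gamma> + \<alpha>)"
      using add by (auto simp: supp_iff coeffs_term split: if_splits)
    moreover have "\<delta> \<in> expos" using d supp_expos by auto
    ultimately show "(\<delta> + lexpo g, lind g) \<in> Q'"
      using add g by (intro assms(4)[OF add(4)]) (auto simp: add.assoc)
  qed
  moreover have "mon \<gamma> *s ((r * mon \<alpha>) *s g + v) = (mon \<gamma> * (r * mon \<alpha>)) *s g + mon \<gamma> *s v"
    by (simp add: vector_add_ldistrib vector_smult_assoc)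
  ultimately show ?case using add by (auto intro: tspan_add)
qed

lemma tspan_mon_sdown:
  assumes "\<gamma> \<in> expos" "v \<in> tspan G (sdown (\<theta>, k))" "0 \<notin> G" "\<theta> \<in> expos"
  shows "mon \<gamma> *s v \<in> tspan G (sdown (\<gamma> + \<theta>, k))"
proof (rule tspan_mon[OF assms(1-3)])
  fix \<beta> i \<delta>
  assume a: "(\<beta>, i) \<in> sdown (\<theta>, k)" "\<beta> \<in> expos" "\<delta> \<in> expos" "\<delta> = \<gamma> + \<beta> \<or> tdeg \<delta> < tdeg (\<gamma> + \<beta>)"
  have "(\<delta>, i) \<in> down (\<gamma> + \<beta>, i)"
    using a assms(1) ord_refl[of "(\<gamma> + \<beta>, i)"] sdown_down[OF sdown_deg] by auto
  then show "(\<delta>, i) \<in> sdown (\<gamma> + \<theta>, k)"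
    using sdown_shift[OF a(1) assms(1)] sdown_trans by blast
qed

lemma tspan_smult:
  assumes "v \<in> tspan G UNIV" "0 \<notin> G"
  shows "a *s v \<in> tspan G UNIV"
proof -
  have "a *s v = (\<Sum>\<alpha>\<in>supp a. coeffs a \<alpha> *s (mon \<alpha> *s v))"
    using arg_cong[OF expand[of a], of "\<lambda>p. p *s v"] by (simp add: sum_smult vector_smult_assoc)
  also have "\<dots> \<in> tspan G UNIV"
    using supp_expos coeffs_R by (intro tspan_sum tspan_lmult tspan_mon[OF _ assms]) auto
  finally show ?thesis .
qed

lemma tspan_vsupp:
  assumes "v \<in> tspan G Q" "0 \<notin> G" "\<And>Y. Y \<in> Q \<Longrightarrow> down Y \<subseteq> Q"
  shows "vsupp v \<subseteq> Q"
  using assms(1)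
proof (induction rule: tspan.induct)
  case (add g r \<alpha> v)
  then have "g \<noteq> 0" using assms(2) by auto
  with add vsupp_term[of \<alpha> r g] assms(3)[OF add(4)] show ?case by (intro vsupp_add) auto
qed simp

lemma tspan_vsupp_down: "v \<in> tspan G (down X) \<Longrightarrow> 0 \<notin> G \<Longrightarrow> vsupp v \<subseteq> down X"
  by (rule tspan_vsupp) (auto intro: down_trans)

lemma tspan_vsupp_sdown: "v \<in> tspan G (sdown X) \<Longrightarrow> 0 \<notin> G \<Longrightarrow> vsupp v \<subseteq> sdown X"
  by (rule tspan_vsupp) (auto intro: sdown_trans)

text \<open>
  The finitely many summands have a largest leading monomial.
\<close>

lemma tspan_bounded:
  assumes "v \<in> tspan G Q" "0 \<notin> G"
  shows "v = 0 \<or> (\<exists>X\<in>Q. v \<in> tspan G (down X))"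
  using assms(1)
proof (induction rule: tspan.induct)
  case (add g r \<alpha> v)
  let ?Y = "(\<alpha> + lexpo g, lind g)"
  have "g \<noteq> 0" using add assms by auto
  then have e: "fst ?Y \<in> expos" using add lexpo_expos by auto
  have t: "(r * mon \<alpha>) *s g \<in> tspan G (down X)" if "?Y \<in> down X" for X
    using add that by (intro tspan_term) auto
  from add.IH show ?case
  proof
    assume "v = 0" then show ?thesis using t[OF ord_refl[OF e]] add by auto
  next
    assume "\<exists>X\<in>Q. v \<in> tspan G (down X)"
    then obtain X where X: "X \<in> Q" "v \<in> tspan G (down X)" by auto
    consider "?Y \<in> down X" | "X \<in> down ?Y" | "fst X \<notin> expos"
      using down_total[of ?Y X] e ord_refl[of X] sdown_down by blast
    then show ?thesis
    proof cases
      case 1 then show ?thesis using X t[of X] by (auto intro: tspan_add)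
    next
      case 2
      then have "v \<in> tspan G (down ?Y)" using X tspan_mono[OF X(2)] down_trans by blast
      then show ?thesis using t[OF ord_refl[OF e]] add by (auto intro: tspan_add)
    next
      case 3
      then have "down X = {}" using down_expos by blast
      then have "v \<in> tspan G (down ?Y)" using X tspan_mono[OF X(2)] by blast
      then show ?thesis using t[OF ord_refl[OF e]] add by (auto intro: tspan_add)
    qed
  qed
qed simp

definition divisors :: "('a ^ 'm) set \<Rightarrow> expo \<times> 'm \<Rightarrow> ('a ^ 'm) set" where
  "divisors G X = {g \<in> G. lind g = snd X \<and> lexpo g \<le> fst X}"

lemma expo_diff_add: "\<beta> \<le> \<alpha> \<Longrightarrow> \<alpha> - \<beta> + \<beta> = (\<alpha> :: expo)"
  by (auto simp: fun_eq_iff le_fun_def)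

lemma combination_fun_upd:
  assumes "finite S" "g \<in> S"
  shows "combination S \<delta> (a(g := r + a g)) = (r * mon (\<delta> - lexpo g)) *s g + combination S \<delta> a"
proof -
  have "(\<Sum>h\<in>S - {g}. ((a(g := r + a g)) h * mon (\<delta> - lexpo h)) *s h)
      = (\<Sum>h\<in>S - {g}. (a h * mon (\<delta> - lexpo h)) *s h)" by (rule sum.cong) auto
  then show ?thesis using assms
    unfolding combination_def by (simp add: sum.remove[OF assms] vec_eq_iff distrib_right add.assoc)
qed

text \<open>
  The summands leading exactly at \<open>X\<close> are collected by generator: for each \<open>g\<close> there is only one
  exponent that moves its leading monomial to \<open>X\<close>.
\<close>

lemma tspan_split:
  assumes "v \<in> tspan G (down X)" "finite G"
  obtains a where "\<And>g. a g \<in> R" "v - combination (divisors G X) (fst X) a \<in> tspan G (sdown X)"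
proof -
  let ?S = "divisors G X"
  have fin: "finite ?S" using assms(2) by (simp add: divisors_def)
  from assms(1) have "\<exists>a. (\<forall>g. a g \<in> R) \<and> v - combination ?S (fst X) a \<in> tspan G (sdown X)"
  proof (induction rule: tspan.induct)
    case zero
    then show ?case by (intro exI[of _ "\<lambda>_. 0"]) (auto simp: combination_def tspan.zero)
  next
    case (add g r \<alpha> v)
    then obtain a where a: "\<And>g. a g \<in> R" "v - combination ?S (fst X) a \<in> tspan G (sdown X)" by auto
    show ?case
    proof (cases "(\<alpha> + lexpo g, lind g) = X")
      case True
      then have X: "X = (\<alpha> + lexpo g, lind g)" by simp
      have g: "g \<in> ?S" using add X by (auto simp: divisors_def le_fun_def)
      have d: "fst X - lexpo g = \<alpha>" by (auto simp: X fun_eq_iff)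
      show ?thesis
        using a add combination_fun_upd[OF fin g, of "fst X" a r]
        by (intro exI[of _ "a(g := r + a g)"]) (simp add: d del: fun_upd_apply, simp)
    next
      case False
      then have "(r * mon \<alpha>) *s g + (v - combination ?S (fst X) a) \<in> tspan G (sdown X)"
        using add a by (intro tspan.add) (auto simp: down_iff)
      then show ?thesis using a by (intro exI[of _ a]) (auto simp: add_diff_eq)
    qed
  qed
  then show ?thesis using that by blast
qed

text \<open>
  All summands lead at the same monomial, so the coefficients there simply add up.
\<close>

lemma
  assumes "0 \<notin> S" "\<And>g. g \<in> S \<Longrightarrow> a g \<in> R" "\<delta> \<in> expos" "\<And>g. g \<in> S \<Longrightarrow> lind g = k \<and> lexpo g \<le> \<delta>"
  shows vcoeff_combination: "vcoeff (combination S \<delta> a) (\<delta>, k)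
      = (\<Sum>g\<in>S. a g * (sigma_pow (\<delta> - lexpo g) (lc g) * cmul (\<delta> - lexpo g) (lexpo g)))"
    and vsupp_combination: "vsupp (combination S \<delta> a) \<subseteq> down (\<delta>, k)"
proof -
  have e: "\<delta> - lexpo g + lexpo g = \<delta>" "lind g = k" "g \<noteq> 0" "a g \<in> R" "\<delta> - lexpo g \<in> expos" if "g \<in> S" for g
    using assms that expo_diff_add by auto
  show "vcoeff (combination S \<delta> a) (\<delta>, k)
      = (\<Sum>g\<in>S. a g * (sigma_pow (\<delta> - lexpo g) (lc g) * cmul (\<delta> - lexpo g) (lexpo g)))"
    unfolding combination_def vcoeff_sum
  proof (rule sum.cong)
    fix g assume "g \<in> S"
    from e[OF this] show "vcoeff ((a g * mon (\<delta> - lexpo g)) *s g) (\<delta>, k)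
       = a g * (sigma_pow (\<delta> - lexpo g) (lc g) * cmul (\<delta> - lexpo g) (lexpo g))"
      using vcoeff_term[of "\<delta> - lexpo g" "a g" g] by (simp add: mult.assoc)
  qed simp
  show "vsupp (combination S \<delta> a) \<subseteq> down (\<delta>, k)"
    unfolding combination_def
  proof (rule vsupp_sum)
    fix g assume "g \<in> S"
    from e[OF this] show "vsupp ((a g * mon (\<delta> - lexpo g)) *s g) \<subseteq> down (\<delta>, k)"
      using vsupp_term[of "\<delta> - lexpo g" "a g" g] by simp
  qed
qed

section \<open>Reduction\<close>

lemma reducibleI:
  assumes "f \<noteq> 0"
    and "\<And>g r \<alpha>. (g, r, \<alpha>) \<in> set ts \<Longrightarrow>
      g \<in> F \<and> r \<in> R \<and> \<alpha> \<in> expos \<and> lind g = lind f \<and> \<alpha> + lexpo g = lexpo f"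
    and "lc f = (\<Sum>(g, r, \<alpha>)\<leftarrow>ts. r * sigma_pow \<alpha> (lc g) * cmul \<alpha> (lexpo g))"
  shows "reducible F f"
  unfolding reducible_def red_def using assms by blast

lemma red_sum:
  assumes "f \<noteq> 0" "0 \<notin> F"
    and "\<forall>(g, r, \<alpha>)\<in>set ts. g \<in> F \<and> r \<in> R \<and> \<alpha> \<in> expos \<and> lind g = lind f \<and> \<alpha> + lexpo g = lexpo f"
  shows "(\<Sum>(g, r, \<alpha>)\<leftarrow>ts. (r * mon \<alpha>) *s g) \<in> tspan F (down (lm f))"
    and "vcoeff (\<Sum>(g, r, \<alpha>)\<leftarrow>ts. (r * mon \<alpha>) *s g) (lm f)
      = (\<Sum>(g, r, \<alpha>)\<leftarrow>ts. r * sigma_pow \<alpha> (lc g) * cmul \<alpha> (lexpo g))"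
proof -
  have "(\<Sum>(g, r, \<alpha>)\<leftarrow>ts. (r * mon \<alpha>) *s g) \<in> tspan F (down (lm f)) \<and>
     vcoeff (\<Sum>(g, r, \<alpha>)\<leftarrow>ts. (r * mon \<alpha>) *s g) (lm f)
      = (\<Sum>(g, r, \<alpha>)\<leftarrow>ts. r * sigma_pow \<alpha> (lc g) * cmul \<alpha> (lexpo g))"
    using assms(3)
  proof (induction ts)
    case Nil
    then show ?case by (simp add: tspan.zero vcoeff_0)
  next
    case (Cons t ts)
    obtain g r \<alpha> where t: "t = (g, r, \<alpha>)" by (cases t)
    have g: "g \<in> F" "r \<in> R" "\<alpha> \<in> expos" "lind g = lind f" "\<alpha> + lexpo g = lexpo f" "g \<noteq> 0"
      using Cons.prems t assms(2) by (auto simp del: plus_fun_apply)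
    have e: "(\<alpha> + lexpo g, lind g) = lm f" using g by (simp add: lm_eq)
    have "lm f \<in> down (lm f)" using vsupp_expos[OF lm_in[OF assms(1)]] by (rule ord_refl)
    then have "(r * mon \<alpha>) *s g \<in> tspan F (down (lm f))" using g e by (intro tspan_term) auto
    moreover have "vcoeff ((r * mon \<alpha>) *s g) (lm f) = r * sigma_pow \<alpha> (lc g) * cmul \<alpha> (lexpo g)"
      using vcoeff_term[OF g(3,2,6)] unfolding e .
    ultimately show ?case using Cons t by (simp add: vcoeff_add tspan_add)
  qed
  then show "(\<Sum>(g, r, \<alpha>)\<leftarrow>ts. (r * mon \<alpha>) *s g) \<in> tspan F (down (lm f))"
    "vcoeff (\<Sum>(g, r, \<alpha>)\<leftarrow>ts. (r * mon \<alpha>) *s g) (lm f)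
      = (\<Sum>(g, r, \<alpha>)\<leftarrow>ts. r * sigma_pow \<alpha> (lc g) * cmul \<alpha> (lexpo g))" by auto
qed

lemma
  assumes "red F f h" "f \<noteq> 0" "0 \<notin> F"
  shows red_vsupp: "vsupp h \<subseteq> sdown (lm f)" and red_tspan: "f - h \<in> tspan F (down (lm f))"
proof -
  obtain ts where ts:
    "\<forall>(g, r, \<alpha>)\<in>set ts. g \<in> F \<and> r \<in> R \<and> \<alpha> \<in> expos \<and> lind g = lind f \<and> \<alpha> + lexpo g = lexpo f"
    "lc f = (\<Sum>(g, r, \<alpha>)\<leftarrow>ts. r * sigma_pow \<alpha> (lc g) * cmul \<alpha> (lexpo g))"
    "h = f - (\<Sum>(g, r, \<alpha>)\<leftarrow>ts. (r * mon \<alpha>) *s g)"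
    using assms(1,2) unfolding red_def by auto
  note t = red_sum[OF assms(2,3) ts(1)]
  show *: "f - h \<in> tspan F (down (lm f))" using t(1) ts(3) by simp
  have "vsupp h \<subseteq> down (lm f)"
    using vsupp_diff[OF lm_max[OF assms(2)] tspan_vsupp_down[OF * assms(3)]] by simp
  moreover have "vcoeff h (lm f) = 0" using t(2) ts(2,3) by (simp add: vcoeff_diff lc_eq)
  ultimately show "vsupp h \<subseteq> sdown (lm f)" by (rule sdown_of_zero)
qed

text \<open>
  A set \<open>Q\<close> of monomials closed downwards is fixed in advance because the leading monomials of the
  intermediate vectors vary, and a reduction chain that reaches \<open>0\<close> has none at its end.
\<close>

lemma reds_props:
  assumes "(red F)\<^sup>*\<^sup>* f r" "0 \<notin> F" "vsupp f \<subseteq> Q" "\<And>Y. Y \<in> Q \<Longrightarrow> down Y \<subseteq> Q"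
  shows "vsupp r \<subseteq> Q \<and> f - r \<in> tspan F Q"
  using assms(1)
proof (induction rule: rtranclp_induct)
  case base then show ?case using assms(3) by (simp add: tspan.zero)
next
  case (step g h)
  show ?case
  proof (cases "g = 0")
    case True
    then show ?thesis using step by (auto simp: red_def)
  next
    case False
    have "down (lm g) \<subseteq> Q" using lm_in[OF False] step.IH assms(4) by blast
    then have "vsupp h \<subseteq> Q" "g - h \<in> tspan F Q"
      using red_vsupp[OF step.hyps(2) False assms(2)] sdown_down
        tspan_mono[OF red_tspan[OF step.hyps(2) False assms(2)]] by blast+
    then show ?thesis using tspan_add[of "f - g" F Q "g - h"] step.IH by simp
  qed
qed

text \<open>
  Each reduction step lowers the leading monomial, and the order is well-founded.
\<close>

lemma exists_reduced:
  assumes "0 \<notin> F"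
  shows "\<exists>r. (red F)\<^sup>*\<^sup>* f r \<and> \<not> reducible F r"
proof (induction "lm f" arbitrary: f rule: wf_induct_rule[OF wf_sdown])
  case 1
  show ?case
  proof (cases "reducible F f")
    case True
    then obtain h where h: "red F f h" "f \<noteq> 0" by (auto simp: reducible_def)
    show ?thesis
    proof (cases "h = 0")
      case True
      then have "\<not> reducible F h" by (simp add: reducible_def)
      then show ?thesis using h by blast
    next
      case False
      have "lm h \<in> sdown (lm f)" using lm_in[OF False] red_vsupp[OF h assms] by blast
      then obtain r where "(red F)\<^sup>*\<^sup>* h r" "\<not> reducible F r" using 1[of h] by auto
      then show ?thesis using h(1) by (meson converse_rtranclp_into_rtranclp)
    qed
  qed blast
qed

text \<open>
  If no summand leads above the leading monomial of \<open>f\<close>, the summands leading there account for the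
  leading coefficient, which is what a reduction step asks for.
\<close>

lemma reducible_if_tspan:
  assumes "f \<in> tspan G (down (lm f))" "f \<noteq> 0" "finite G" "0 \<notin> G"
  shows "reducible G f"
proof -
  let ?S = "divisors G (lm f)"
  obtain a where a: "\<And>g. a g \<in> R" "f - combination ?S (lexpo f) a \<in> tspan G (sdown (lm f))"
    using tspan_split[OF assms(1,3)] by (auto simp: lexpo_def)
  have S: "lind g = lind f \<and> lexpo g \<le> lexpo f" if "g \<in> ?S" for g
    using that by (auto simp: divisors_def lexpo_def lind_def)
  have "lm f \<notin> vsupp (f - combination ?S (lexpo f) a)"
    using tspan_vsupp_sdown[OF a(2) assms(4)] by (auto simp: sdown_def)
  then have "lc f = vcoeff (combination ?S (lexpo f) a) (lm f)"
    by (simp add: vsupp_iff vcoeff_diff lc_eq)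
  also have "\<dots> = (\<Sum>g\<in>?S. a g * (sigma_pow (lexpo f - lexpo g) (lc g) * cmul (lexpo f - lexpo g) (lexpo g)))"
    unfolding lm_eq
  proof (rule vcoeff_combination)
    show "0 \<notin> divisors G (lexpo f, lind f)" using assms(4) by (simp add: divisors_def)
    show "lind g = lind f \<and> lexpo g \<le> lexpo f" if "g \<in> divisors G (lexpo f, lind f)" for g
      using S that by (simp add: lm_eq)
  qed (use a lexpo_expos[OF assms(2)] in blast)+
  finally have lc: "lc f = \<dots>" .
  have "finite ?S" using assms(3) by (simp add: divisors_def)
  then obtain l where l: "set l = ?S" "distinct l" using finite_distinct_list by blast
  show ?thesis
  proof (rule reducibleI[OF assms(2), of "map (\<lambda>g. (g, a g, lexpo f - lexpo g)) l"])
    fix g r \<alpha> assume "(g, r, \<alpha>) \<in> set (map (\<lambda>g. (g, a g, lexpo f - lexpo g)) l)"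
    then have "g \<in> ?S" "r = a g" "\<alpha> = lexpo f - lexpo g" using l by auto
    then show "g \<in> G \<and> r \<in> R \<and> \<alpha> \<in> expos \<and> lind g = lind f \<and> \<alpha> + lexpo g = lexpo f"
      using S[of g] a expo_diff_add lexpo_expos[OF assms(2)] by (auto simp: divisors_def)
  next
    have "(\<Sum>(g, r, \<alpha>)\<leftarrow>map (\<lambda>g. (g, a g, lexpo f - lexpo g)) l.
        r * sigma_pow \<alpha> (lc g) * cmul \<alpha> (lexpo g))
      = (\<Sum>g\<leftarrow>l. a g * (sigma_pow (lexpo f - lexpo g) (lc g) * cmul (lexpo f - lexpo g) (lexpo g)))"
      unfolding map_map o_def split_conv mult.assoc ..
    also have "\<dots> = lc f"
      unfolding lc sum_list_distinct_conv_sum_set[OF l(2)] l(1) ..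
    finally show "lc f = (\<Sum>(g, r, \<alpha>)\<leftarrow>map (\<lambda>g. (g, a g, lexpo f - lexpo g)) l.
        r * sigma_pow \<alpha> (lc g) * cmul \<alpha> (lexpo g))" ..
  qed
qed

section \<open>Sequences of irreducible vectors are finite\<close>

lemma reducible_mono: "reducible F f \<Longrightarrow> F \<subseteq> G \<Longrightarrow> reducible G f"
  unfolding reducible_def red_def by fast

lemma sigma_pow_sum:
  assumes "\<alpha> \<in> expos" "\<And>i. i \<in> I \<Longrightarrow> f i \<in> R"
  shows "sigma_pow \<alpha> (sum f I) = (\<Sum>i\<in>I. sigma_pow \<alpha> (f i))"
  using assms(2)
  by (induction I rule: infinite_finite_induct)
    (auto simp: sigma_pow_zero assms(1) sigma_pow_add R_sum)

text \<open>
  Reducibility as membership in a left ideal that does not depend on the exponents.  Applying the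
  automorphism \<open>\<sigma>\<^sup>\<beta>\<close>, with \<open>\<beta>\<close> the leading exponent of \<open>f\<close>, to the equation for \<open>\<rho>\<close> gives a
  combination of the \<open>\<sigma>\<^sup>\<beta>(q\<^sub>j)\<close>, and \<open>sigma_pow_compose\<close> exchanges these for the products
  \<open>\<sigma>\<^sup>\<alpha>(lc g\<^sub>j) c\<close> at the cost of a unit on the left.
\<close>

lemma reducible_if_ideal:
  fixes g :: "nat \<Rightarrow> 'a ^ 'm"
  assumes "f \<noteq> 0" "\<rho> \<in> R" "lc f = sigma_pow (lexpo f) \<rho>"
    and g: "\<And>j. j < N \<Longrightarrow> g j \<in> F \<and> g j \<noteq> 0 \<and> lind (g j) = lind f \<and> lexpo (g j) \<le> lexpo f"
    and q: "\<And>j. j < N \<Longrightarrow> q j \<in> R \<and> lc (g j) = sigma_pow (lexpo (g j)) (q j)"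
    and s: "\<And>j. j < N \<Longrightarrow> s j \<in> R" and eq: "\<rho> = (\<Sum>j<N. s j * q j)"
  shows "reducible F f"
proof -
  let ?\<beta> = "lexpo f" and ?c = "\<lambda>j. cmul (lexpo f - lexpo (g j)) (lexpo (g j))"
  have \<beta>: "?\<beta> \<in> expos" using assms(1) lexpo_expos by blast
  have "\<exists>d. d \<in> R \<and> d * ?c j = 1" if "j < N" for j
    using cmul_runit[of "lexpo f - lexpo (g j)" "lexpo (g j)"] that g \<beta> lexpo_expos
    unfolding runit_def by (metis expos_diff)
  then obtain d where d: "\<And>j. j < N \<Longrightarrow> d j \<in> R \<and> d j * ?c j = 1" by metis
  define ts where "ts = map (\<lambda>j. (g j, sigma_pow ?\<beta> (s j) * d j, ?\<beta> - lexpo (g j))) [0..<N]"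
  have t: "sigma_pow ?\<beta> (s j) * d j * sigma_pow (?\<beta> - lexpo (g j)) (lc (g j)) * ?c j
      = sigma_pow ?\<beta> (s j * q j)" if j: "j < N" for j
  proof -
    have e: "lexpo (g j) \<in> expos" "?\<beta> - lexpo (g j) + lexpo (g j) = ?\<beta>"
      using g[OF j] lexpo_expos expo_diff_add by auto
    have "sigma_pow (?\<beta> - lexpo (g j)) (lc (g j)) * ?c j = ?c j * sigma_pow ?\<beta> (q j)"
      using sigma_pow_compose[of "?\<beta> - lexpo (g j)" "lexpo (g j)" "q j"] e \<beta> q[OF j] by simp
    then have "sigma_pow ?\<beta> (s j) * d j * (sigma_pow (?\<beta> - lexpo (g j)) (lc (g j)) * ?c j)
        = sigma_pow ?\<beta> (s j) * (d j * ?c j) * sigma_pow ?\<beta> (q j)"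
      by (simp add: mult.assoc)
    then show ?thesis using d[OF j] sigma_pow_mult[OF \<beta>] s[OF j] q[OF j] by (simp add: mult.assoc)
  qed
  show ?thesis
  proof (rule reducibleI[OF assms(1), of ts])
    fix h r \<alpha> assume "(h, r, \<alpha>) \<in> set ts"
    then obtain j where "j < N" "h = g j" "r = sigma_pow ?\<beta> (s j) * d j" "\<alpha> = ?\<beta> - lexpo (g j)"
      by (auto simp: ts_def)
    then show "h \<in> F \<and> r \<in> R \<and> \<alpha> \<in> expos \<and> lind h = lind f \<and> \<alpha> + lexpo h = lexpo f"
      using g d s \<beta> expo_diff_add sigma_pow_R by simp
  next
    have "lc f = (\<Sum>j<N. sigma_pow ?\<beta> (s j * q j))"
      unfolding assms(3) eq by (rule sigma_pow_sum[OF \<beta>]) (use s q in auto)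
    also have "\<dots> = (\<Sum>j<N. sigma_pow ?\<beta> (s j) * d j * sigma_pow (?\<beta> - lexpo (g j)) (lc (g j)) * ?c j)"
      using t by (intro sum.cong) auto
    also have "\<dots> = (\<Sum>(h, r, \<alpha>)\<leftarrow>ts. r * sigma_pow \<alpha> (lc h) * cmul \<alpha> (lexpo h))"
      by (simp add: ts_def o_def interv_sum_list_conv_sum_set_nat atLeast0LessThan)
    finally show "lc f = (\<Sum>(h, r, \<alpha>)\<leftarrow>ts. r * sigma_pow \<alpha> (lc h) * cmul \<alpha> (lexpo h))" .
  qed
qed

text \<open>
  This replaces a Hilbert basis theorem.  On a subsequence with constant index and increasing leading exponents,
  all earlier leading monomials divide the later ones, so \<open>reducible_if_ideal\<close> applies with
  all earlier members.  The ascending chain of left ideals generated by the \<open>q\<^sub>j\<close> becomes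
  stationary, and where it stops growing the next member is reducible.
\<close>

theorem no_infinite_irreducible_sequence:
  fixes f :: "nat \<Rightarrow> 'a ^ 'm"
  assumes "left_noetherian R" "\<And>k. f k \<noteq> 0"
  shows "\<exists>k. reducible (f ` {..<k}) (f k)"
proof -
  obtain r1 :: "nat \<Rightarrow> nat" and k where r1: "strict_mono r1" "\<And>j. lind (f (r1 j)) = k"
    by (rule finite_constant_subseq[of "\<lambda>j. lind (f j)"]) blast
  obtain r2 :: "nat \<Rightarrow> nat" where r2: "strict_mono r2" "\<forall>i\<in>{..<n}. mono (\<lambda>j. lexpo (f (r1 (r2 j))) i)"
    using dickson_subseq[of "{..<n}" "\<lambda>j. lexpo (f (r1 j))"] by auto
  define g where "g j = f (r1 (r2 j))" for j
  have g0: "g j \<noteq> 0" for j using assms(2) by (simp add: g_def)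
  have le: "lexpo (g i) \<le> lexpo (g j)" if "i \<le> j" for i j
  proof (rule le_funI)
    fix l show "lexpo (g i) l \<le> lexpo (g j) l"
    proof (cases "l < n")
      case True then show ?thesis using r2(2) that by (auto simp: mono_def g_def)
    next
      case False then show ?thesis using lexpo_expos[OF g0[of i]] by (simp add: expos_def)
    qed
  qed
  have "\<exists>q. q \<in> R \<and> lc (g j) = sigma_pow (lexpo (g j)) q" for j
    using sigma_pow_surj[OF lexpo_expos[OF g0] lc_R] by metis
  then obtain q where q: "\<And>j. q j \<in> R \<and> lc (g j) = sigma_pow (lexpo (g j)) (q j)" by metis
  define I where "I m = {\<Sum>j<m. s j * q j | s. \<forall>j. s j \<in> R}" for m
  have ideal: "left_ideal_of R (I m)" for m
    unfolding left_ideal_of_def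
  proof (intro conjI ballI)
    show "I m \<subseteq> R" using q by (auto simp: I_def intro!: R_sum)
    show "0 \<in> I m" unfolding I_def by (rule CollectI, rule exI[of _ "\<lambda>_. 0"]) simp
  next
    fix a b assume "a \<in> I m" "b \<in> I m"
    then obtain s t where "a = (\<Sum>j<m. s j * q j)" "b = (\<Sum>j<m. t j * q j)" "\<forall>j. s j \<in> R" "\<forall>j. t j \<in> R"
      unfolding I_def by blast
    then show "a + b \<in> I m" unfolding I_def
      by (intro CollectI exI[of _ "\<lambda>j. s j + t j"]) (simp add: distrib_right sum.distrib)
  next
    fix c a assume "c \<in> R" "a \<in> I m"
    then obtain s where "a = (\<Sum>j<m. s j * q j)" "\<forall>j. s j \<in> R" unfolding I_def by blast
    then show "c * a \<in> I m" unfolding I_def using \<open>c \<in> R\<close>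
      by (intro CollectI exI[of _ "\<lambda>j. c * s j"]) (simp add: sum_distrib_left mult.assoc)
  qed
  have asc: "I m \<subseteq> I (Suc m)" for m
  proof
    fix a assume "a \<in> I m"
    then obtain s where s: "a = (\<Sum>j<m. s j * q j)" "\<forall>j. s j \<in> R" unfolding I_def by blast
    have "(\<Sum>j<m. s j * q j) = (\<Sum>j<Suc m. (s(m := 0)) j * q j)" by simp
    then show "a \<in> I (Suc m)" unfolding I_def using s
      by (intro CollectI exI[of _ "s(m := 0)"]) simp
  qed
  have "\<exists>N. \<forall>m\<ge>N. I m = I N"
    using assms(1)[unfolded left_noetherian_def, rule_format, of I] ideal asc by blast
  then obtain N where "\<forall>m\<ge>N. I m = I N" ..
  then have "I (Suc N) = I N" using le_SucI[OF order_refl, of N] by blast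
  moreover have "q N \<in> I (Suc N)"
  proof -
    define e where "e j = (if j = N then 1 else 0 :: 'a)" for j
    have "(\<Sum>j<N. e j * q j) = 0" by (intro sum.neutral) (auto simp: e_def)
    moreover have "e N = 1" by (simp add: e_def)
    ultimately have "q N = (\<Sum>j<Suc N. e j * q j)"
      unfolding sum.lessThan_Suc by (simp only: add_0 mult_1)
    moreover have "\<forall>j. e j \<in> R" by (simp add: e_def)
    ultimately show ?thesis unfolding I_def by blast
  qed
  ultimately obtain s where s: "q N = (\<Sum>j<N. s j * q j)" "\<forall>j. s j \<in> R" unfolding I_def by blast
  have "reducible (f ` {..<r1 (r2 N)}) (g N)"
  proof (rule reducible_if_ideal[OF g0])
    show "q N \<in> R" "lc (g N) = sigma_pow (lexpo (g N)) (q N)" using q by auto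
    show "q N = (\<Sum>j<N. s j * q j)" by (rule s)
    fix j assume j: "j < N"
    then have "r1 (r2 j) < r1 (r2 N)" using strict_monoD[OF r1(1) strict_monoD[OF r2(1)]] by blast
    then show "g j \<in> f ` {..<r1 (r2 N)} \<and> g j \<noteq> 0 \<and> lind (g j) = lind (g N) \<and> lexpo (g j) \<le> lexpo (g N)"
      using g0 le j r1(2) by (simp add: g_def)
    show "q j \<in> R \<and> lc (g j) = sigma_pow (lexpo (g j)) (q j)" by (rule q)
    show "s j \<in> R" using s by simp
  qed
  then show ?thesis unfolding g_def by blast
qed

section \<open>The syzygy criterion\<close>

text \<open>
  The row of which \<open>B\<^sub>S\<close> generates the syzygies: the entry at \<open>g\<close> is the leading coefficient of \<open>x\<^sup>\<gamma> g\<close>,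
  where \<open>\<gamma>\<close> moves the leading monomial of \<open>g\<close> to \<open>\<theta>\<close>.
\<close>

abbreviation lead_row :: "expo \<Rightarrow> 'a ^ 'm \<Rightarrow> 'a" where
  "lead_row \<theta> \<equiv> (\<lambda>g. sigma_pow (\<theta> - lexpo g) (lc g) * cmul (\<theta> - lexpo g) (lexpo g))"

lemma lcm_of_SomeD:
  assumes "lcm_of S = Some (\<theta>, k)" "finite S" "0 \<notin> S"
  shows "\<theta> \<in> expos" and "\<And>g. g \<in> S \<Longrightarrow> lind g = k \<and> lexpo g \<le> \<theta>"
proof -
  obtain k' where k': "lind ` S = {k'}" using assms(1) by (auto simp: lcm_of_def split: if_splits)
  then have S: "S \<noteq> {}" by auto
  have \<theta>: "\<theta> = (\<lambda>i. Max ((\<lambda>g. lexpo g i) ` S))" and k: "k = k'"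
    using assms(1) k' by (auto simp: lcm_of_def)
  show "lind g = k \<and> lexpo g \<le> \<theta>" if "g \<in> S" for g
    using that k k' assms(2) by (auto simp: \<theta> le_fun_def)
  show "\<theta> \<in> expos"
  proof -
    have "Max ((\<lambda>g. lexpo g i) ` S) = 0" if "i \<ge> n" for i
    proof -
      have "lexpo g i = 0" if "g \<in> S" for g
        using lexpo_expos[of g] that assms(3) \<open>i \<ge> n\<close> by (auto simp: expos_def)
      then have "(\<lambda>g. lexpo g i) ` S = {0}" using S by force
      then show ?thesis by simp
    qed
    then show ?thesis by (simp add: \<theta> expos_def)
  qed
qed

lemma lcm_of_le:
  assumes "finite S" "S \<noteq> {}" "\<And>g. g \<in> S \<Longrightarrow> lind g = k \<and> lexpo g \<le> \<delta>"
  obtains \<theta> where "lcm_of S = Some (\<theta>, k)" "\<theta> \<le> \<delta>"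
proof -
  let ?t = "\<lambda>i. Max ((\<lambda>g. lexpo g i) ` S)"
  have k: "lind ` S = {k}" using assms(2,3) by force
  then have "lcm_of S = Some (?t, k)" by (simp add: lcm_of_def)
  moreover have "?t \<le> \<delta>"
    using assms by (auto simp: le_fun_def)
  ultimately show ?thesis using that by blast
qed

lemma combination_add: "combination S \<theta> (b + c) = combination S \<theta> b + combination S \<theta> c"
  by (simp add: combination_def vec_eq_iff sum.distrib distrib_right)

lemma combination_lmult: "combination S \<theta> (\<lambda>g. r * b g) = r *s combination S \<theta> b"
  by (simp add: combination_def vec_eq_iff sum_distrib_left mult.assoc)

lemma combination_zero: "combination S \<theta> 0 = 0"
  by (simp add: combination_def vec_eq_iff)

text \<open>
  The coefficient at \<open>\<^bold>X\<^sub>S\<close> is the sum that the syzygy condition makes vanish.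
\<close>

lemma syz_combination:
  assumes "lcm_of S = Some (\<theta>, k)" "finite S" "0 \<notin> S" "b \<in> syz R S (lead_row \<theta>)"
  shows "vsupp (combination S \<theta> b) \<subseteq> sdown (\<theta>, k)"
proof (rule sdown_of_zero)
  note l = lcm_of_SomeD[OF assms(1-3)]
  have b: "\<And>g. g \<in> S \<Longrightarrow> b g \<in> R" "(\<Sum>g\<in>S. b g * lead_row \<theta> g) = 0"
    using assms(4) by (auto simp: syz_def)
  show "vsupp (combination S \<theta> b) \<subseteq> down (\<theta>, k)"
    using vsupp_combination[of S b \<theta> k, OF assms(3) b(1) l] by blast
  show "vcoeff (combination S \<theta> b) (\<theta>, k) = 0"
    using vcoeff_combination[of S b \<theta> k, OF assms(3) b(1) l] b(2) by simp
qed

text \<open>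
  What the algorithm ensures for a visited subset: the combinations have representations whose
  terms lie below the monomial at which cancellation took place.
\<close>

definition resolved :: "('a ^ 'm) set \<Rightarrow> ('a ^ 'm) set \<Rightarrow> bool" where
  "resolved G S \<longleftrightarrow> (\<forall>\<theta> k. lcm_of S = Some (\<theta>, k) \<longrightarrow>
     (\<exists>B. is_BS S \<theta> B \<and> (\<forall>b\<in>B. combination S \<theta> b \<in> tspan G (sdown (\<theta>, k)))))"

lemma resolved_syz:
  assumes "resolved G S" "lcm_of S = Some (\<theta>, k)" "b \<in> syz R S (lead_row \<theta>)"
  shows "combination S \<theta> b \<in> tspan G (sdown (\<theta>, k))"
proof -
  obtain B where B: "is_BS S \<theta> B" "\<forall>b\<in>B. combination S \<theta> b \<in> tspan G (sdown (\<theta>, k))"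
    using assms(1,2) unfolding resolved_def by blast
  let ?N = "{b. combination S \<theta> b \<in> tspan G (sdown (\<theta>, k))}"
  have "row_submodule R ?N"
    unfolding row_submodule_def
    by (auto simp: combination_zero combination_add combination_lmult tspan.zero tspan_add tspan_lmult)
  then have "row_submodule R hull B \<subseteq> ?N" using B(2) by (intro hull_minimal) auto
  then show ?thesis using B(1) assms(3) unfolding is_BS_def finite_generating_set_def by blast
qed

text \<open>
  Let \<open>\<theta>\<close> be the exponent of \<open>\<^bold>X\<^sub>S\<close> and \<open>\<delta> = \<eta> + \<theta>\<close>.  The coefficients \<open>b\<close> are chosen so that \<open>x\<^sup>\<eta>\<close> times the
  combination of \<open>b\<close> at \<open>\<theta>\<close> agrees with the given combination at \<open>\<delta>\<close> up to terms of smaller degree.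
  Therefore the cancellation at \<open>\<delta>\<close> forces cancellation at \<open>\<theta>\<close>, because \<open>\<sigma>\<^sup>\<eta>\<close> is injective and \<open>c\<close> is a
  unit.  So \<open>b\<close> is a syzygy, its combination is a sum of terms below \<open>\<theta>\<close>, and multiplication
  with \<open>x\<^sup>\<eta>\<close> keeps them below \<open>\<delta>\<close>.  Comparing coefficients at \<open>\<delta>\<close> avoids any identity between the
  various \<open>c\<close>.
\<close>

lemma cancelling_top_part:
  assumes fin: "finite S" and nz: "0 \<notin> S" and SG: "S \<subseteq> G" and nzG: "0 \<notin> G" and res: "resolved G S"
    and \<delta>: "\<delta> \<in> expos" and div: "\<And>g. g \<in> S \<Longrightarrow> lind g = k \<and> lexpo g \<le> \<delta>"
    and a: "\<And>g. a g \<in> R" and top0: "vcoeff (combination S \<delta> a) (\<delta>, k) = 0"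
  shows "combination S \<delta> a \<in> tspan G (sdown (\<delta>, k))"
proof (cases "S = {}")
  case True
  then show ?thesis by (simp add: combination_def tspan.zero)
next
  case False
  obtain \<theta> where \<theta>: "lcm_of S = Some (\<theta>, k)" "\<theta> \<le> \<delta>" using lcm_of_le[OF fin False div] .
  note l = lcm_of_SomeD[OF \<theta>(1) fin nz]
  define \<eta> where "\<eta> = \<delta> - \<theta>"
  have \<eta>: "\<eta> \<in> expos" "\<eta> + \<theta> = \<delta>" using \<delta> \<theta>(2) expo_diff_add by (auto simp: \<eta>_def)
  have \<eta>g: "\<eta> + (\<theta> - lexpo g) = \<delta> - lexpo g" "\<theta> - lexpo g \<in> expos" "\<delta> - lexpo g + lexpo g = \<delta>"
    if "g \<in> S" for g
  proof -
    have "lexpo g \<le> \<theta>" using l(2)[OF that] by simp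
    then show "\<eta> + (\<theta> - lexpo g) = \<delta> - lexpo g"
      using \<theta>(2) by (auto simp: \<eta>_def fun_eq_iff le_fun_def)
    show "\<theta> - lexpo g \<in> expos" using l(1) by simp
    show "\<delta> - lexpo g + lexpo g = \<delta>" using div[OF that] expo_diff_add by blast
  qed
  \<comment> \<open>This is where bijectivity of the extension is used: the twist by \<open>\<sigma>\<^sup>\<eta>\<close> and by the unit is undone.\<close>
  have "\<exists>b. b \<in> R \<and> sigma_pow \<eta> b * cmul \<eta> (\<theta> - lexpo g) = a g" if g: "g \<in> S" for g
  proof -
    obtain d where d: "d \<in> R" "d * cmul \<eta> (\<theta> - lexpo g) = 1"
      using cmul_runit[OF \<eta>(1) \<eta>g(2)[OF g]] unfolding runit_def by auto
    obtain b where b: "b \<in> R" "sigma_pow \<eta> b = a g * d"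
      using sigma_pow_surj[OF \<eta>(1)] a d(1) R_closed(5) by metis
    then have "sigma_pow \<eta> b * cmul \<eta> (\<theta> - lexpo g) = a g" using d(2) by (simp add: mult.assoc)
    then show ?thesis using b by blast
  qed
  then obtain b' where b': "\<And>g. g \<in> S \<Longrightarrow> b' g \<in> R \<and> sigma_pow \<eta> (b' g) * cmul \<eta> (\<theta> - lexpo g) = a g"
    by metis
  define b where "b g = (if g \<in> S then b' g else 0)" for g
  have b: "\<And>g. g \<in> S \<Longrightarrow> b g \<in> R" "\<And>g. g \<in> S \<Longrightarrow> sigma_pow \<eta> (b g) * cmul \<eta> (\<theta> - lexpo g) = a g"
    using b' by (auto simp: b_def)
  let ?c = "combination S \<theta> b" and ?T = "combination S \<delta> a"
  have "mon \<eta> *s ?c - ?T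
      = (\<Sum>g\<in>S. (mon \<eta> * (b g * mon (\<theta> - lexpo g)) - a g * mon (\<delta> - lexpo g)) *s g)"
    unfolding combination_def
    by (simp add: vec_eq_iff sum_distrib_left mult.assoc left_diff_distrib sum_subtractf)
  also have "\<dots> \<in> tspan G (sdown (\<delta>, k))"
  proof (rule tspan_sum, rule tspan_scalar)
    fix g \<alpha> assume g: "g \<in> S"
      and s: "\<alpha> \<in> supp (mon \<eta> * (b g * mon (\<theta> - lexpo g)) - a g * mon (\<delta> - lexpo g))"
    have "mon \<eta> * (b g * mon (\<theta> - lexpo g)) - a g * mon (\<delta> - lexpo g) \<in> lowdeg (tdeg (\<delta> - lexpo g))"
      using mon_term[OF \<eta>(1) \<eta>g(2)[OF g] b(1)[OF g]] unfolding b(2)[OF g] \<eta>g(1)[OF g] .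
    then have "tdeg \<alpha> < tdeg (\<delta> - lexpo g)" using s by (auto simp: lowdeg_def)
    moreover have "\<alpha> \<in> expos" "lexpo g \<in> expos" "lind g = k"
      using s supp_expos g nz lexpo_expos div by (blast, metis, blast)
    moreover have "tdeg \<delta> = tdeg (\<delta> - lexpo g) + tdeg (lexpo g)"
      using arg_cong[OF \<eta>g(3)[OF g], of tdeg] unfolding tdeg_add by (rule sym)
    ultimately show "(\<alpha> + lexpo g, lind g) \<in> sdown (\<delta>, k)"
      using \<delta> by (auto intro!: sdown_deg)
  qed (use SG in blast)
  finally have diff: "mon \<eta> *s ?c - ?T \<in> tspan G (sdown (\<delta>, k))" .
  have "(\<delta>, k) \<notin> vsupp (mon \<eta> *s ?c - ?T)"
    using tspan_vsupp_sdown[OF diff nzG] by (auto simp: sdown_def)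
  then have "vcoeff (mon \<eta> *s ?c) (\<eta> + \<theta>, k) = 0"
    using top0 by (simp add: vsupp_iff vcoeff_diff \<eta>(2))
  then have "sigma_pow \<eta> (vcoeff ?c (\<theta>, k)) * cmul \<eta> \<theta> = 0"
    using vcoeff_mon[OF \<eta>(1) vsupp_combination[OF nz b(1) l(1) l(2)] l(1)] by simp
  then have "sigma_pow \<eta> (vcoeff ?c (\<theta>, k)) = 0" using runit_cancel[OF cmul_runit[OF \<eta>(1) l(1)]] by blast
  then have "vcoeff ?c (\<theta>, k) = 0" by (rule sigma_pow_eq_0[OF \<eta>(1) vcoeff_R])
  then have "(\<Sum>g\<in>S. b g * lead_row \<theta> g) = 0"
    using vcoeff_combination[OF nz b(1) l(1) l(2)] by simp
  then have "b \<in> syz R S (lead_row \<theta>)" using b(1) by (simp add: syz_def b_def)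
  from resolved_syz[OF res \<theta>(1) this] have "?c \<in> tspan G (sdown (\<theta>, k))" .
  from tspan_mon_sdown[OF \<eta>(1) this nzG l(1)] have "mon \<eta> *s ?c \<in> tspan G (sdown (\<delta>, k))"
    unfolding \<eta>(2) .
  from tspan_diff[OF this diff] show ?thesis by simp
qed

text \<open>
  Descent along the order: a bound \<open>X\<close> other than the leading monomial of \<open>f\<close> can be lowered, since the
  part leading at \<open>X\<close> has coefficient \<open>0\<close> there.
\<close>

lemma tspan_lower:
  assumes fin: "finite G" and nz: "0 \<notin> G" and res: "\<And>S. S \<subseteq> G \<Longrightarrow> resolved G S"
    and f: "f \<in> tspan G (down X)" "f \<noteq> 0"
  shows "f \<in> tspan G (down (lm f))"
  using f(1)
proof (induction X rule: wf_induct_rule[OF wf_sdown])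
  case (1 X)
  show ?case
  proof (cases "X = lm f")
    case True
    then show ?thesis using 1 by simp
  next
    case False
    let ?S = "divisors G X"
    have le: "lm f \<in> down X" using tspan_vsupp_down[OF 1(2) nz] lm_in[OF f(2)] by blast
    then have X: "fst X \<in> expos" using down_expos by blast
    have "X \<notin> vsupp f" using lm_max[OF f(2)] le ord_antisym False by blast
    then have f0: "vcoeff f X = 0" by (simp add: vsupp_iff)
    obtain a where a: "\<And>g. a g \<in> R" "f - combination ?S (fst X) a \<in> tspan G (sdown X)"
      using tspan_split[OF 1(2) fin] by blast
    have "X \<notin> vsupp (f - combination ?S (fst X) a)"
      using tspan_vsupp_sdown[OF a(2) nz] by (auto simp: sdown_def)
    then have "vcoeff (combination ?S (fst X) a) (fst X, snd X) = 0"
      using f0 by (simp add: vsupp_iff vcoeff_diff)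
    then have "combination ?S (fst X) a \<in> tspan G (sdown (fst X, snd X))"
      by (intro cancelling_top_part) (use fin nz res X a in \<open>auto simp: divisors_def\<close>)
    then have "f \<in> tspan G (sdown X)" using tspan_add[OF a(2), of "combination ?S (fst X) a"] by simp
    then obtain Y where "Y \<in> sdown X" "f \<in> tspan G (down Y)"
      using tspan_bounded[OF _ nz] f(2) by blast
    then show ?thesis using 1(1) by blast
  qed
qed

theorem resolved_imp_reducible:
  assumes "finite G" "0 \<notin> G" "\<And>S. S \<subseteq> G \<Longrightarrow> resolved G S" "f \<in> tspan G UNIV" "f \<noteq> 0"
  shows "reducible G f"
  using tspan_bounded[OF assms(4,2)] tspan_lower[OF assms(1-3)] assms reducible_if_tspan by blast

section \<open>Correctness and termination of the algorithm\<close>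

lemma submodule_sum: "submodule M \<Longrightarrow> (\<And>i. i \<in> I \<Longrightarrow> f i \<in> M) \<Longrightarrow> sum f I \<in> M"
  by (induction I rule: infinite_finite_induct) (auto simp: submodule_def)

lemma submodule_diff: assumes "submodule M" "u \<in> M" "v \<in> M" shows "u - v \<in> M"
proof -
  have "u + (-1) *s v \<in> M" using assms by (auto simp: submodule_def)
  then show ?thesis by (simp add: vector_sneg_minus1[symmetric])
qed

lemma tspan_submodule: "v \<in> tspan G Q \<Longrightarrow> submodule M \<Longrightarrow> G \<subseteq> M \<Longrightarrow> v \<in> M"
  by (induction rule: tspan.induct) (auto simp: submodule_def)

lemma combination_submodule:
  "submodule M \<Longrightarrow> S \<subseteq> M \<Longrightarrow> combination S \<theta> b \<in> M"
  unfolding combination_def by (rule submodule_sum) (auto simp: submodule_def)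

lemma generator_tspan: assumes "g \<in> G" "(lexpo g, lind g) \<in> Q" shows "g \<in> tspan G Q"
  using tspan_term[of g G 1 0 Q] assms by simp

lemma submodule_hull_tspan:
  assumes "F \<subseteq> G" "0 \<notin> G" "v \<in> submodule hull F"
  shows "v \<in> tspan G UNIV"
proof -
  have "submodule (tspan G UNIV)"
    unfolding submodule_def using assms(2) by (auto simp: tspan.zero tspan_add tspan_smult)
  moreover have "F \<subseteq> tspan G UNIV" using assms(1) by (auto intro: generator_tspan)
  ultimately show ?thesis using assms(3) hull_minimal by blast
qed

type_synonym (in -) ('a, 'm) bstate =
  "('a ^ 'm) set \<times> ('a ^ 'm) set \<times> ('a ^ 'm) set set \<times> (('a ^ 'm) set \<times> expo \<times> (('a ^ 'm) \<Rightarrow> 'a)) set"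

text \<open>
  The last clause says that every subset of \<open>G\<close> which is not waiting in \<open>D\<close> is resolved with
  respect to \<open>G'\<close>, apart from the combinations still waiting in \<open>P\<close>.  Initially \<open>G\<close> is empty and its
  only subset has no least common multiple; when the loop is entered again, the old subsets are
  resolved and the new ones are put into \<open>D\<close>.
\<close>

definition invariant :: "('a ^ 'm) set \<Rightarrow> ('a, 'm) bstate \<Rightarrow> bool" where
  "invariant F = (\<lambda>(G, G', D, P).
     finite G' \<and> F \<subseteq> G' \<and> G' \<subseteq> submodule hull F \<and> 0 \<notin> G' \<and> G \<subseteq> G' \<and> D \<subseteq> Pow G \<and> finite P \<and>
     (\<forall>(S, \<theta>, b)\<in>P. S \<subseteq> G \<and> (\<exists>k. lcm_of S = Some (\<theta>, k)) \<and> b \<in> syz R S (lead_row \<theta>)) \<and>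
     (\<forall>S\<in>Pow G - D. \<forall>\<theta> k. lcm_of S = Some (\<theta>, k) \<longrightarrow>
        (\<exists>B. is_BS S \<theta> B \<and>
          (\<forall>b\<in>B. (S, \<theta>, b) \<in> P \<or> combination S \<theta> b \<in> tspan G' (sdown (\<theta>, k))))))"

lemma invariantD:
  assumes "invariant F (G, G', D, P)"
  shows "finite G'" "F \<subseteq> G'" "G' \<subseteq> submodule hull F" "0 \<notin> G'" "G \<subseteq> G'" "D \<subseteq> Pow G" "finite P"
    "(S, \<theta>, b) \<in> P \<Longrightarrow> S \<subseteq> G \<and> (\<exists>k. lcm_of S = Some (\<theta>, k)) \<and> b \<in> syz R S (lead_row \<theta>)"
    "S \<subseteq> G \<Longrightarrow> S \<notin> D \<Longrightarrow> lcm_of S = Some (\<theta>, k) \<Longrightarrow>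
      \<exists>B. is_BS S \<theta> B \<and> (\<forall>b\<in>B. (S, \<theta>, b) \<in> P \<or> combination S \<theta> b \<in> tspan G' (sdown (\<theta>, k)))"
  using assms unfolding invariant_def by (simp_all, blast+)

lemma invariantI:
  assumes "finite G'" "F \<subseteq> G'" "G' \<subseteq> submodule hull F" "0 \<notin> G'" "G \<subseteq> G'" "D \<subseteq> Pow G" "finite P"
    "\<And>S \<theta> b. (S, \<theta>, b) \<in> P \<Longrightarrow> S \<subseteq> G \<and> (\<exists>k. lcm_of S = Some (\<theta>, k)) \<and> b \<in> syz R S (lead_row \<theta>)"
    "\<And>S \<theta> k. S \<subseteq> G \<Longrightarrow> S \<notin> D \<Longrightarrow> lcm_of S = Some (\<theta>, k) \<Longrightarrow>
      \<exists>B. is_BS S \<theta> B \<and> (\<forall>b\<in>B. (S, \<theta>, b) \<in> P \<or> combination S \<theta> b \<in> tspan G' (sdown (\<theta>, k)))"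
  shows "invariant F (G, G', D, P)"
proof -
  have "\<forall>(S, \<theta>, b)\<in>P. S \<subseteq> G \<and> (\<exists>k. lcm_of S = Some (\<theta>, k)) \<and> b \<in> syz R S (lead_row \<theta>)"
    using assms(8) by blast
  moreover have "\<forall>S\<in>Pow G - D. \<forall>\<theta> k. lcm_of S = Some (\<theta>, k) \<longrightarrow>
    (\<exists>B. is_BS S \<theta> B \<and> (\<forall>b\<in>B. (S, \<theta>, b) \<in> P \<or> combination S \<theta> b \<in> tspan G' (sdown (\<theta>, k))))"
    using assms(9) by blast
  ultimately show ?thesis unfolding invariant_def prod.case using assms(1-7) by (intro conjI)
qed

lemma invariant_initial:
  assumes "finite F" "0 \<notin> F"
  shows "invariant F ({}, F, {}, {})"
  by (rule invariantI) (use assms hull_subset[of F submodule] in \<open>auto simp: lcm_of_def\<close>)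

lemma invariant_step:
  assumes "step s s'" "invariant F s"
  shows "invariant F s'"
  using assms
proof (induction rule: step.induct)
  case (enter_loop G' G)
  note i = invariantD[OF enter_loop(2)]
  show ?case
  proof (rule invariantI)
    fix S \<theta> k assume "S \<subseteq> G'" "S \<notin> Pow G' - Pow G" "lcm_of S = Some (\<theta>, k)"
    then show "\<exists>B. is_BS S \<theta> B \<and> (\<forall>b\<in>B. (S, \<theta>, b) \<in> {} \<or> combination S \<theta> b \<in> tspan G' (sdown (\<theta>, k)))"
      using i(9)[of S \<theta> k] by blast
  qed (use i in auto)
next
  case (skip S D G G')
  note i = invariantD[OF skip(3)]
  show ?case
  proof (rule invariantI)
    fix S' \<theta> k assume "S' \<subseteq> G" "S' \<notin> D - {S}" "lcm_of S' = Some (\<theta>, k)"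
    then show "\<exists>B. is_BS S' \<theta> B \<and> (\<forall>b\<in>B. (S', \<theta>, b) \<in> {} \<or> combination S' \<theta> b \<in> tspan G' (sdown (\<theta>, k)))"
      using i(9)[of S' \<theta> k] skip(2) by fastforce
  qed (use i in auto)
next
  case (visit S D \<theta> k B G G')
  note i = invariantD[OF visit(4)]
  have B: "finite B" "B \<subseteq> syz R S (lead_row \<theta>)"
    using visit(3) hull_subset[of B "row_submodule R"] unfolding is_BS_def finite_generating_set_def by auto
  show ?case
  proof (rule invariantI)
    fix S' \<theta>' k' assume a: "S' \<subseteq> G" "S' \<notin> D - {S}" "lcm_of S' = Some (\<theta>', k')"
    show "\<exists>B'. is_BS S' \<theta>' B' \<and>
      (\<forall>b\<in>B'. (S', \<theta>', b) \<in> {S} \<times> {\<theta>} \<times> B \<or> combination S' \<theta>' b \<in> tspan G' (sdown (\<theta>', k')))"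
    proof (cases "S' = S")
      case True
      then have "\<theta>' = \<theta>" using a(3) visit(2) by simp
      then show ?thesis using visit(3) True by blast
    next
      case False
      then show ?thesis using i(9)[of S' \<theta>' k'] a by blast
    qed
  next
    fix S' \<theta>' b assume "(S', \<theta>', b) \<in> {S} \<times> {\<theta>} \<times> B"
    then show "S' \<subseteq> G \<and> (\<exists>k. lcm_of S' = Some (\<theta>', k)) \<and> b \<in> syz R S' (lead_row \<theta>')"
      using visit(1,2) i(6) B(2) by auto
  qed (use i B in auto)
next
  case (reduce S \<theta> b P G' r G D)
  note i = invariantD[OF reduce(4)]
  let ?H = "if r = 0 then G' else insert r G'" and ?f = "combination S \<theta> b"
  obtain k where S: "S \<subseteq> G" "lcm_of S = Some (\<theta>, k)" "b \<in> syz R S (lead_row \<theta>)"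
    using i(8)[OF reduce(1)] by blast
  have S': "finite S" "0 \<notin> S" "S \<subseteq> submodule hull F"
    using S(1) i(1,3,4,5) by (auto dest: finite_subset)
  have "vsupp r \<subseteq> sdown (\<theta>, k) \<and> ?f - r \<in> tspan G' (sdown (\<theta>, k))"
    using reds_props[OF reduce(2) i(4) syz_combination[OF S(2) S'(1,2) S(3)]]
      sdown_trans by blast
  then have r: "vsupp r \<subseteq> sdown (\<theta>, k)" "?f - r \<in> tspan G' (sdown (\<theta>, k))" by auto
  have "?f \<in> submodule hull F" "?f - r \<in> submodule hull F"
    using combination_submodule[OF submodule_hull S'(3)] tspan_submodule[OF r(2) submodule_hull i(3)] by auto
  from submodule_diff[OF submodule_hull this] have rM: "r \<in> submodule hull F" by simp
  have sub: "G' \<subseteq> ?H" by auto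
  \<comment> \<open>Adding the remainder to \<open>G'\<close> turns it into a single term with a leading monomial below \<open>\<^bold>X\<^sub>S\<close>.\<close>
  have fH: "?f \<in> tspan ?H (sdown (\<theta>, k))"
  proof -
    have "r \<in> tspan ?H (sdown (\<theta>, k))"
    proof (cases "r = 0")
      case False
      then show ?thesis using r(1) lm_in[OF False] by (intro generator_tspan) (auto simp: lm_eq)
    qed (simp add: tspan.zero)
    from tspan_add[OF tspan_mono[OF r(2) sub order_refl] this] show ?thesis by simp
  qed
  show ?case
  proof (rule invariantI)
    fix S1 \<theta>1 k1 assume a: "S1 \<subseteq> G" "S1 \<notin> D" "lcm_of S1 = Some (\<theta>1, k1)"
    obtain B where B: "is_BS S1 \<theta>1 B"
      "\<forall>b\<in>B. (S1, \<theta>1, b) \<in> P \<or> combination S1 \<theta>1 b \<in> tspan G' (sdown (\<theta>1, k1))"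
      using i(9)[OF a] by blast
    have "(S1, \<theta>1, b1) \<in> P - {(S, \<theta>, b)} \<or> combination S1 \<theta>1 b1 \<in> tspan ?H (sdown (\<theta>1, k1))"
      if b1: "b1 \<in> B" for b1
    proof (cases "(S1, \<theta>1, b1) = (S, \<theta>, b)")
      case True
      then have "k1 = k" using a(3) S(2) by simp
      then show ?thesis using fH True by blast
    next
      case False
      then show ?thesis using B(2) b1 tspan_mono[OF _ sub order_refl] by blast
    qed
    then show "\<exists>B. is_BS S1 \<theta>1 B \<and> (\<forall>b1\<in>B. (S1, \<theta>1, b1) \<in> P - {(S, \<theta>, b)}
        \<or> combination S1 \<theta>1 b1 \<in> tspan ?H (sdown (\<theta>1, k1)))" using B(1) by blast
  next
    fix S1 \<theta>1 b1 assume "(S1, \<theta>1, b1) \<in> P - {(S, \<theta>, b)}"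
    then show "S1 \<subseteq> G \<and> (\<exists>k. lcm_of S1 = Some (\<theta>1, k)) \<and> b1 \<in> syz R S1 (lead_row \<theta>1)"
      using i(8) by blast
  qed (use i(1-7) rM in \<open>auto split: if_splits\<close>)
qed

lemma step_exists:
  assumes lgs: "left_groebner_soluble R" and inv: "invariant F (G, G', D, P)"
    and unfinished: "\<not> (G = G' \<and> D = {} \<and> P = {})"
  shows "\<exists>s'. step (G, G', D, P) s'"
proof -
  note i = invariantD[OF inv]
  consider "P \<noteq> {}" | "P = {}" "D \<noteq> {}" | "P = {}" "D = {}" "G' \<noteq> G" using unfinished by blast
  then show ?thesis
  proof cases
    case 1
    then obtain S \<theta> b where "(S, \<theta>, b) \<in> P" by auto
    then show ?thesis using exists_reduced[OF i(4)] step.reduce by blast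
  next
    case 2
    then obtain S where S: "S \<in> D" by blast
    show ?thesis
    proof (cases "lcm_of S")
      case None
      then show ?thesis using step.skip S 2 by blast
    next
      case (Some X)
      obtain \<theta> k where X: "X = (\<theta>, k)" by (cases X)
      have S': "finite S" "0 \<notin> S" using S i(1,4-6) by (auto dest: finite_subset)
      note l = lcm_of_SomeD[OF Some[unfolded X] S']
      have "lead_row \<theta> g \<in> R" if "g \<in> S" for g
      proof -
        have "lexpo g \<in> expos" using that S'(2) lexpo_expos by metis
        then show ?thesis using l(1) lc_R sigma_pow_R runit_R[OF cmul_runit] by simp
      qed
      from syz_finitely_generated[of R S "lead_row \<theta>", OF lgs S'(1) this] obtain B where "is_BS S \<theta> B"
        unfolding is_BS_def by blast
      then show ?thesis using step.visit[OF S Some[unfolded X]] 2 by blast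
    qed
  next
    case 3
    then show ?thesis using step.enter_loop by blast
  qed
qed

text \<open>
  The larger set comes first, so that well-foundedness excludes infinite growth.
\<close>

definition growth :: "(('a ^ 'm) set \<times> ('a ^ 'm) set) set" where
  "growth = {(insert r G, G) | r G. r \<noteq> 0 \<and> \<not> reducible G r}"

lemma wf_growth:
  assumes "left_noetherian R"
  shows "wf growth"
  unfolding wf_iff_no_infinite_down_chain
proof
  assume "\<exists>Gs. \<forall>k. (Gs (Suc k), Gs k) \<in> growth"
  then obtain Gs where "\<forall>k. (Gs (Suc k), Gs k) \<in> growth" by blast
  then have "\<forall>k. \<exists>r. r \<noteq> 0 \<and> \<not> reducible (Gs k) r \<and> Gs (Suc k) = insert r (Gs k)"
    unfolding growth_def by blast
  then obtain r where r: "\<And>k. r k \<noteq> 0" "\<And>k. \<not> reducible (Gs k) (r k)"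
    "\<And>k. Gs (Suc k) = insert (r k) (Gs k)" by metis
  have sub: "r ` {..<k} \<subseteq> Gs k" for k
    by (induction k) (auto simp: r(3) lessThan_Suc)
  obtain k where "reducible (r ` {..<k}) (r k)"
    using no_infinite_irreducible_sequence[of r] assms r(1) by metis
  from reducible_mono[OF this sub] show False using r(2) by blast
qed

text \<open>
  Lexicographically: growth of \<open>G'\<close>; the flag \<open>G \<noteq> G'\<close>, which entering the loop resets; the subsets
  and the combinations still to be treated.
\<close>

definition progress :: "('a, 'm) bstate rel" where
  "progress = inv_image (growth <*lex*> less_than <*lex*> less_than <*lex*> less_than)
     (\<lambda>(G, G', D, P). (G', if G = G' then 0 else 1, card D, card P))"

lemma step_progress:
  assumes "step s s'" "invariant F s"
  shows "(s', s) \<in> progress"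
  using assms
proof (induction rule: step.induct)
  case (enter_loop G' G)
  then show ?case by (auto simp: progress_def)
next
  case (skip S D G G')
  note i = invariantD[OF skip(3)]
  have "finite D" using i(1,5,6) by (meson finite_Pow_iff finite_subset)
  then have "card (D - {S}) < card D" using skip(1) by (rule card_Diff1_less)
  then show ?case unfolding progress_def by (simp del: card_Diff_singleton)
next
  case (visit S D \<theta> k B G G')
  note i = invariantD[OF visit(4)]
  have "finite D" using i(1,5,6) by (meson finite_Pow_iff finite_subset)
  then have "card (D - {S}) < card D" using visit(1) by (rule card_Diff1_less)
  then show ?case unfolding progress_def by (simp del: card_Diff_singleton)
next
  case (reduce S \<theta> b P G' r G D)
  note i = invariantD[OF reduce(4)]
  have "card (P - {(S, \<theta>, b)}) < card P" using i(7) reduce(1) by (rule card_Diff1_less)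
  moreover have "(insert r G', G') \<in> growth" if "r \<noteq> 0"
    using reduce(3) that by (auto simp: growth_def)
  ultimately show ?case unfolding progress_def by (simp del: card_Diff_singleton)
qed

lemma step_terminates:
  assumes "left_noetherian R" "invariant F s"
  shows "termip step s"
proof -
  have "wf progress" unfolding progress_def by (intro wf_inv_image wf_lex_prod wf_growth[OF assms(1)] wf_less_than)
  then show ?thesis using assms(2)
  proof (induction s rule: wf_induct_rule)
    case (less s)
    show ?case
    proof (rule accpI)
      fix s' assume "step^--1 s' s"
      then have "step s s'" by simp
      then show "termip step s'"
        using less step_progress invariant_step by blast
    qed
  qed
qed

lemma reachable_invariant: "step\<^sup>*\<^sup>* s s' \<Longrightarrow> invariant F s \<Longrightarrow> invariant F s'"
  by (induction rule: rtranclp_induct) (auto intro: invariant_step)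

lemma invariant_groebner:
  assumes "invariant F (G, G, {}, {})" "F \<noteq> {}" "0 \<notin> F"
  shows "groebner_basis G (submodule hull F)"
proof -
  note i = invariantD[OF assms(1)]
  obtain f where "f \<in> F" "f \<noteq> 0" using assms(2,3) by (metis all_not_in_conv)
  then have "submodule hull F \<noteq> {0}" using hull_subset[of F submodule] by blast
  moreover have "reducible G f" if "f \<in> submodule hull F - {0}" for f
  proof (rule resolved_imp_reducible[OF i(1,4)])
    show "resolved G S" if "S \<subseteq> G" for S
      unfolding resolved_def using i(9)[OF that] by blast
    show "f \<in> tspan G UNIV" using submodule_hull_tspan[OF i(2,4)] that by blast
    show "f \<noteq> 0" using that by blast
  qed
  ultimately show ?thesis
    unfolding groebner_basis_def using i(1-4) assms(2) by auto
qed

end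

theorem corollary116:
  fixes R :: "'a::ring_1 set" and n :: nat and x :: "nat \<Rightarrow> 'a"
    and ordA :: "expo rel" and ord :: "(expo \<times> 'm::finite) rel"
    and F :: "('a ^ 'm) set"
  assumes "pbw.bijective_skew_pbw R n x"
    and "left_groebner_soluble R"
    and "pbw.monomial_order R n x ordA"
    and "pbw.monomial_order_vec R n x ordA ord"
    and "finite F" and "F \<noteq> {}" and "0 \<notin> F"
  shows "termip (pbw_module.step R n x ord) ({}, F, {}, {}) \<and>
    (\<forall>s. (pbw_module.step R n x ord)\<^sup>*\<^sup>* ({}, F, {}, {}) s \<and> (\<nexists>s'. pbw_module.step R n x ord s s') \<longrightarrow>
      (\<exists>G. s = (G, G, {}, {}) \<and> pbw_module.groebner_basis R n x ord G (submodule hull F)))"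
proof -
  interpret bijective_pbw_module R n x ord ordA
    by unfold_locales (fact assms)+
  have init: "invariant F ({}, F, {}, {})" using invariant_initial assms by blast
  have "left_noetherian R" using assms(2) by (simp add: left_groebner_soluble_def)
  then have "termip step ({}, F, {}, {})" using step_terminates init by blast
  moreover have "\<exists>G. s = (G, G, {}, {}) \<and> groebner_basis G (submodule hull F)"
    if s: "step\<^sup>*\<^sup>* ({}, F, {}, {}) s" "\<nexists>s'. step s s'" for s
  proof -
    obtain G G' D P where e: "s = (G, G', D, P)" by (cases s)
    have inv: "invariant F (G, G', D, P)" using reachable_invariant[OF s(1) init] e by simp
    then have "G = G' \<and> D = {} \<and> P = {}" using step_exists[OF assms(2) inv] s(2) e by blast
    then show ?thesis using invariant_groebner inv assms(6,7) e by blast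
  qed
  ultimately show ?thesis by blast
qed

end
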